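(* Let $G$ be a split graph with vertex partition $\{X,Y\}$, where $X=\{v_1,\ldots,v_n\}$ is a maximal clique of $G$ and $Y=V(G)\setminus X$ is a stable set, and write $d_i=|N_G(v_i)\cap Y|$ for $1\le i\le n$, with the vertices labelled so that $d_1\ge d_2\ge\cdots\ge d_n$. If $n\ge 10$, then: (i) $\chi'_{\rm irr}(G)\le 2$ if and only if $d_1\ge\lfloor n/2\rfloor$ or $d_2\ge 1$; (ii) $\chi'_{\rm irr}(G)=3$ if and only if $d_1<\lfloor n/2\rfloor$ and $d_2=0$.
   Context: All graphs are finite and simple. A graph is locally irregular if any two adjacent vertices have distinct degrees. A decomposition of $G$ is a collection of subgraphs whose edge sets partition $E(G)$; a locally irregular decomposition is one in which every subgraph is locally irregular. $G$ is decomposable if it admits a locally irregular decomposition, and for decomposable $G$ the irregular chromatic index $\chi'_{\rm irr}(G)$ is the minimum number of subgraphs in a locally irregular decomposition of $G$ (equivalently, the minimum number of colors in an edge coloring in which each color class induces a locally irregular graph). A split graph is a graph whose vertex set can be partitioned into a clique and a stable set. *)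

theory Defs
  imports Main
begin

definition simple_graph :: "'a set \<Rightarrow> 'a set set \<Rightarrow> bool" where
  "simple_graph V E \<longleftrightarrow> finite V \<and>
     (\<forall>e\<in>E. \<exists>u w. u \<noteq> w \<and> u \<in> V \<and> w \<in> V \<and> e = {u, w})"

definition neighbors :: "'a set set \<Rightarrow> 'a \<Rightarrow> 'a set" where
  "neighbors E u = {w. w \<noteq> u \<and> {u, w} \<in> E}"

definition deg :: "'a set set \<Rightarrow> 'a \<Rightarrow> nat" where
  "deg F u = card {e\<in>F. u \<in> e}"

definition locally_irregular :: "'a set set \<Rightarrow> bool" where
  "locally_irregular F \<longleftrightarrow> (\<forall>u w. u \<noteq> w \<and> {u, w} \<in> F \<longrightarrow> deg F u \<noteq> deg F w)"

text \<open>A locally irregular decomposition into (at most) k subgraphs, given as an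
  edge colouring c with colours 0..k-1 whose colour classes are locally irregular.\<close>
definition irr_decomp :: "'a set set \<Rightarrow> nat \<Rightarrow> ('a set \<Rightarrow> nat) \<Rightarrow> bool" where
  "irr_decomp E k c \<longleftrightarrow> (\<forall>e\<in>E. c e < k) \<and>
     (\<forall>j<k. locally_irregular {e\<in>E. c e = j})"

definition decomposable :: "'a set set \<Rightarrow> bool" where
  "decomposable E \<longleftrightarrow> (\<exists>k c. irr_decomp E k c)"

definition irr_chromatic_index :: "'a set set \<Rightarrow> nat" where
  "irr_chromatic_index E = (LEAST k. \<exists>c. irr_decomp E k c)"

definition is_clique :: "'a set \<Rightarrow> 'a set set \<Rightarrow> 'a set \<Rightarrow> bool" where
  "is_clique V E X \<longleftrightarrow> X \<subseteq> V \<and> (\<forall>u\<in>X. \<forall>w\<in>X. u \<noteq> w \<longrightarrow> {u, w} \<in> E)"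

definition maximal_clique :: "'a set \<Rightarrow> 'a set set \<Rightarrow> 'a set \<Rightarrow> bool" where
  "maximal_clique V E X \<longleftrightarrow> is_clique V E X \<and>
     \<not> (\<exists>w\<in>V - X. is_clique V E (insert w X))"

definition stable_set :: "'a set \<Rightarrow> 'a set set \<Rightarrow> 'a set \<Rightarrow> bool" where
  "stable_set V E Y \<longleftrightarrow> Y \<subseteq> V \<and> (\<forall>u\<in>Y. \<forall>w\<in>Y. {u, w} \<notin> E)"

end

theory Submission
  imports Defs
begin

text \<open>Write d(x) for the number of neighbours of a clique vertex x outside the clique X.

  If the d(x) sum to at least n div 2, split X into halves A and B, colour the clique on A and all
  outer edges at A red, those at B blue, and put a red half graph between A and B. The vertices of A
  (of B) then have red (blue) degrees consisting of a constant, a rank and d(x). If at least n div 2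
  vertices have d(x) > 0, A is taken among them and ranks are sorted by d; otherwise vertices
  with d > 0 get the ranks 1, 1 + d(x), 1 + d(x) + d(x'), ... as long as these are at most |A|, and
  vertices with d = 0 fill the gaps.

  If the sum is smaller but two vertices p and q have d > 0, all vertices except p and q get distinct
  red degrees 1, ..., n - 2 inside X. Since red and blue degree of p add up to n - 1 + d(p), vertex p
  with red degree r causes no conflict if it is blue to the vertex of red degree r and red to the
  vertex of red degree r - d(p); the pattern is perturbed accordingly near p and q.

  If at most one vertex v has d > 0, a 2-colouring forces distinct red degrees on the remaining n - 1
  vertices. Up to swapping colours the red graph is then a threshold graph, so v has exactly
  n div 2 red edges inside X, which is compatible with no d(v) < n div 2. A star at v serves
  as a third colour.\<close>

subsection \<open>Degrees and two-colourings\<close>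

lemma neighbors_sym: "w \<in> neighbors E u \<longleftrightarrow> u \<in> neighbors E w"
  by (auto simp: neighbors_def insert_commute)

lemma deg_eq_card_neighbors:
  assumes "simple_graph V E" and "F \<subseteq> E"
  shows "deg F u = card (neighbors F u)"
proof -
  have "bij_betw (\<lambda>w. {u, w}) (neighbors F u) {e\<in>F. u \<in> e}"
  proof (rule bij_betw_imageI)
    show "inj_on (\<lambda>w. {u, w}) (neighbors F u)"
      by (auto simp: inj_on_def doubleton_eq_iff)
    show "(\<lambda>w. {u, w}) ` neighbors F u = {e\<in>F. u \<in> e}"
    proof
      show "{e\<in>F. u \<in> e} \<subseteq> (\<lambda>w. {u, w}) ` neighbors F u"
      proof
        fix e assume e: "e \<in> {e\<in>F. u \<in> e}"
        with assms obtain x y where "x \<noteq> y" "e = {x, y}"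
          unfolding simple_graph_def by blast
        with e show "e \<in> (\<lambda>w. {u, w}) ` neighbors F u"
          by (auto simp: neighbors_def insert_commute image_iff)
      qed
    qed (auto simp: neighbors_def)
  qed
  then show ?thesis
    unfolding deg_def by (metis bij_betw_same_card)
qed

lemma neighbors_subset:
  assumes "simple_graph V E"
  shows "neighbors E u \<subseteq> V"
proof
  fix w assume "w \<in> neighbors E u"
  then have "{u, w} \<in> E" by (simp add: neighbors_def)
  then obtain x y where "x \<in> V" "y \<in> V" "{u, w} = {x, y}"
    using assms unfolding simple_graph_def by blast
  then show "w \<in> V" by (auto simp: doubleton_eq_iff)
qed

text \<open>Reduces a 2-colouring to a symmetric relation: \<open>R\<close> marks the edges of
  colour 0, and the degrees in both colour classes become cardinalities of parts of
  neighbourhoods.\<close>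

lemma irr_decomp_two:
  assumes G: "simple_graph V E"
    and sym: "\<And>u w. R u w \<longleftrightarrow> R w u"
    and red: "\<And>u w. w \<in> neighbors E u \<Longrightarrow> R u w \<Longrightarrow>
      card {x\<in>neighbors E u. R u x} \<noteq> card {x\<in>neighbors E w. R w x}"
    and blue: "\<And>u w. w \<in> neighbors E u \<Longrightarrow> \<not> R u w \<Longrightarrow>
      card {x\<in>neighbors E u. \<not> R u x} \<noteq> card {x\<in>neighbors E w. \<not> R w x}"
  shows "\<exists>c. irr_decomp E 2 c"
proof -
  define c :: "'a set \<Rightarrow> nat" where
    "c e = (if \<exists>u w. e = {u, w} \<and> R u w then 0 else 1)" for e
  have c: "c {u, w} = 0 \<longleftrightarrow> R u w" for u w
    unfolding c_def using sym by (auto simp: doubleton_eq_iff)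
  then have c1: "c {u, w} = Suc 0 \<longleftrightarrow> \<not> R u w" for u w
    by (metis One_nat_def c_def zero_neq_one)
  have n0: "neighbors {e\<in>E. c e = 0} u = {x\<in>neighbors E u. R u x}" for u
    by (auto simp: neighbors_def c)
  have n1: "neighbors {e\<in>E. c e = Suc 0} u = {x\<in>neighbors E u. \<not> R u x}" for u
    by (auto simp: neighbors_def c1)
  have deg: "deg {e\<in>E. c e = j} u = card (neighbors {e\<in>E. c e = j} u)" for u j
    by (rule deg_eq_card_neighbors[OF G]) auto
  have "locally_irregular {e\<in>E. c e = 0}"
    unfolding locally_irregular_def deg n0
    using red by (auto simp: c neighbors_def)
  moreover have "locally_irregular {e\<in>E. c e = Suc 0}"
    unfolding locally_irregular_def deg n1
    using blue by (auto simp: c1 neighbors_def)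
  ultimately have "irr_decomp E 2 c"
    by (auto simp: irr_decomp_def c_def less_2_cases_iff)
  then show ?thesis by blast
qed

text \<open>The clique is arbitrary, so that the locale can be interpreted again for the graph left
  after deleting a star at v, with clique \<open>X - {v}\<close>. Maximality enters separately, as
  \<open>\<not> X \<subseteq> N y\<close>.\<close>

locale split_graph =
  fixes V :: "'a set" and E :: "'a set set" and X :: "'a set"
  assumes graph: "simple_graph V E"
    and clique: "is_clique V E X"
    and stable: "stable_set V E (V - X)"
begin

abbreviation N :: "'a \<Rightarrow> 'a set" where "N \<equiv> neighbors E"

definition d :: "'a \<Rightarrow> nat" where "d x = card (N x \<inter> (V - X))"

lemma finite_V: "finite V"
  using graph by (simp add: simple_graph_def)

lemma X_subset: "X \<subseteq> V"
  using clique by (simp add: is_clique_def)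

lemma finite_X: "finite X"
  using X_subset finite_V finite_subset by blast

lemma finite_N: "finite (N x)"
  using neighbors_subset[OF graph] finite_V finite_subset by metis

lemma N_clique: "x \<in> X \<Longrightarrow> N x = (X - {x}) \<union> (N x \<inter> (V - X))"
  using clique neighbors_subset[OF graph, of x]
  by (auto simp: is_clique_def neighbors_def)

lemma N_stable: "y \<in> V - X \<Longrightarrow> N y \<subseteq> X"
  using stable neighbors_subset[OF graph, of y]
  by (auto simp: stable_set_def neighbors_def)

lemma d_pos: "x \<in> N y \<Longrightarrow> y \<in> V - X \<Longrightarrow> d x \<ge> 1"
  using neighbors_sym[of x E y] finite_N[of x]
  by (auto simp: d_def Suc_le_eq card_gt_0_iff)

text \<open>Outer edges take their colour from the clique end, red at \<open>A\<close> and blue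
  elsewhere. Thus \<open>r\<close> and \<open>b\<close> are full colour degrees, and a vertex y
  outside X has red degree \<open>card (N y \<inter> A)\<close> and blue degree
  \<open>card (N y - A)\<close>. Only \<open>R\<close> inside X remains to be designed.\<close>

lemma two_colouring:
  fixes r b :: "'a \<Rightarrow> nat"
  assumes sym: "\<And>x x'. R x x' \<longleftrightarrow> R x' x"
    and A: "A \<subseteq> X"
    and r: "\<And>x. x \<in> X \<Longrightarrow> r x = card {x'\<in>X - {x}. R x x'} + (if x \<in> A then d x else 0)"
    and b: "\<And>x. x \<in> X \<Longrightarrow> b x = card {x'\<in>X - {x}. \<not> R x x'} + (if x \<in> A then 0 else d x)"
    and red: "\<And>x x'. x \<in> X \<Longrightarrow> x' \<in> X \<Longrightarrow> x \<noteq> x' \<Longrightarrow> R x x' \<Longrightarrow> r x \<noteq> r x'"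
    and blue: "\<And>x x'. x \<in> X \<Longrightarrow> x' \<in> X \<Longrightarrow> x \<noteq> x' \<Longrightarrow> \<not> R x x' \<Longrightarrow> b x \<noteq> b x'"
    and redY: "\<And>x y. x \<in> A \<Longrightarrow> y \<in> V - X \<Longrightarrow> x \<in> N y \<Longrightarrow> card (N y \<inter> A) \<noteq> r x"
    and blueY: "\<And>x y. x \<in> X - A \<Longrightarrow> y \<in> V - X \<Longrightarrow> x \<in> N y \<Longrightarrow> card (N y - A) \<noteq> b x"
  shows "\<exists>c. irr_decomp E 2 c"
proof -
  define Q where "Q u w = (if u \<in> X \<and> w \<in> X then R u w else u \<in> A \<or> w \<in> A)" for u w
  have rX: "card {w\<in>N x. Q x w} = r x" if x: "x \<in> X" for x
  proof -
    have "{w\<in>N x. Q x w} = {x'\<in>X - {x}. R x x'} \<union> (if x \<in> A then N x \<inter> (V - X) else {})"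
      using N_clique[OF x] A x by (auto simp: Q_def)
    also have "card \<dots> = r x"
      unfolding r[OF x] using finite_X finite_V
      by (subst card_Un_disjoint) (auto simp: d_def)
    finally show ?thesis .
  qed
  have bX: "card {w\<in>N x. \<not> Q x w} = b x" if x: "x \<in> X" for x
  proof -
    have "{w\<in>N x. \<not> Q x w} = {x'\<in>X - {x}. \<not> R x x'} \<union> (if x \<in> A then {} else N x \<inter> (V - X))"
      using N_clique[OF x] A x by (auto simp: Q_def)
    also have "card \<dots> = b x"
      unfolding b[OF x] using finite_X finite_V
      by (subst card_Un_disjoint) (auto simp: d_def)
    finally show ?thesis .
  qed
  have rY: "{w\<in>N y. Q y w} = N y \<inter> A" "{w\<in>N y. \<not> Q y w} = N y - A" if "y \<in> V - X" for y
    using A that by (auto simp: Q_def)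
  have NV: "w \<in> V" "u \<in> V" if "w \<in> N u" for u w
    using that neighbors_subset[OF graph] neighbors_sym[of w E u] by blast+
  show ?thesis
  proof (rule irr_decomp_two[OF graph, where R = Q])
    show "Q u w \<longleftrightarrow> Q w u" for u w
      using sym by (auto simp: Q_def)
  next
    fix u w assume uw: "w \<in> N u" "Q u w"
    then have wu: "u \<in> N w" "w \<noteq> u" using neighbors_sym[of w E u] by (auto simp: neighbors_def)
    consider "u \<in> X" "w \<in> X" | "u \<in> X" "w \<in> V - X" | "u \<in> V - X" "w \<in> X"
      using N_stable[of u] NV[OF uw(1)] uw by blast
    then show "card {x\<in>N u. Q u x} \<noteq> card {x\<in>N w. Q w x}"
    proof cases
      case 1 then show ?thesis using red[of u w] uw wu rX by (auto simp: Q_def)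
    next
      case 2
      then have "u \<in> A" using uw A by (auto simp: Q_def)
      then show ?thesis
        using redY[of u w] uw wu 2 rX[of u] rY(1)[of w] by simp
    next
      case 3
      then have "w \<in> A" using uw A by (auto simp: Q_def)
      then show ?thesis
        using redY[of w u] uw wu 3 rX[of w] rY(1)[of u] by simp
    qed
  next
    fix u w assume uw: "w \<in> N u" "\<not> Q u w"
    then have wu: "u \<in> N w" "w \<noteq> u" using neighbors_sym[of w E u] by (auto simp: neighbors_def)
    consider "u \<in> X" "w \<in> X" | "u \<in> X" "w \<in> V - X" | "u \<in> V - X" "w \<in> X"
      using N_stable[of u] NV[OF uw(1)] uw by blast
    then show "card {x\<in>N u. \<not> Q u x} \<noteq> card {x\<in>N w. \<not> Q w x}"
    proof cases
      case 1 then show ?thesis using blue[of u w] uw wu bX by (auto simp: Q_def)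
    next
      case 2
      then have "u \<notin> A" using uw A by (auto simp: Q_def)
      then show ?thesis
        using blueY[of u w] uw wu 2 bX[of u] rY(2)[of w] by simp
    next
      case 3
      then have "w \<notin> A" using uw A by (auto simp: Q_def)
      then show ?thesis
        using blueY[of w u] uw wu 3 bX[of w] rY(2)[of u] by simp
    qed
  qed
qed

end

section \<open>Sorted rankings and greedy chains of ranks\<close>

lemma card_bij_betw_Collect:
  assumes "bij_betw g S T"
  shows "card {x\<in>S. P (g x)} = card {t\<in>T. P t}"
proof -
  have "bij_betw g {x\<in>S. P (g x)} {t\<in>T. P t}"
    using assms by (auto simp: bij_betw_def inj_on_def)
  then show ?thesis by (rule bij_betw_same_card)
qed

lemma ex_bij_betw_sorted:
  fixes f :: "'a \<Rightarrow> nat"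
  assumes "finite S"
  shows "\<exists>g. bij_betw g S {0..<card S} \<and> (\<forall>x\<in>S. \<forall>y\<in>S. g x < g y \<longrightarrow> f x \<le> f y)"
  using assms
proof (induction rule: finite_ranking_induct[where f = f])
  case empty
  then show ?case by (simp add: bij_betw_def)
next
  case (insert x S)
  show ?case
  proof (cases "x \<in> S")
    case True
    then show ?thesis using insert.IH by (simp add: insert_absorb)
  next
    case False
    from insert.IH obtain g where g: "bij_betw g S {0..<card S}"
      and mono: "\<forall>x\<in>S. \<forall>y\<in>S. g x < g y \<longrightarrow> f x \<le> f y" by blast
    \<comment> \<open>The induction inserts elements in nondecreasing order of \<open>f\<close>, so
      the new one may take the top rank.\<close>
    let ?g = "g(x := card S)"
    have "bij_betw ?g S {0..<card S}"
      using g False by (metis (no_types, lifting) bij_betw_cong fun_upd_other)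
    then have "bij_betw ?g (insert x S) (insert (card S) {0..<card S})"
      using notIn_Un_bij_betw[of x S ?g "{0..<card S}"] False by simp
    moreover have "insert (card S) {0..<card S} = {0..<card (insert x S)}"
      using False insert.hyps by auto
    ultimately have "bij_betw ?g (insert x S) {0..<card (insert x S)}" by simp
    moreover have "f y \<le> f z" if "y \<in> insert x S" "z \<in> insert x S" "?g y < ?g z" for y z
    proof (cases "y = x")
      case True
      have "g z < card S" if "z \<in> S"
        using g that by (auto simp: bij_betw_def)
      then show ?thesis using that True by (auto split: if_splits)
    next
      case False
      then show ?thesis using that mono insert.hyps by (auto split: if_splits)
    qed
    ultimately show ?thesis by blast
  qed
qed

text \<open>The ranks are the partial sums c, c + f x, c + f x + f x', ... as long as they are at
  most a. Adding \<open>f\<close> moves each rank to the next one, except that the last jumps beyond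
  a; the total is large enough for this jump to occur.\<close>

lemma greedy_chain:
  fixes f :: "'a \<Rightarrow> nat"
  assumes "finite P" and "\<And>x. x \<in> P \<Longrightarrow> f x \<ge> 1"
    and "c \<le> a" and "c + sum f P > a"
  shows "\<exists>S u. S \<subseteq> P \<and> inj_on u S \<and> u ` S \<subseteq> {c..a} \<and> c \<in> u ` S \<and>
    inj_on (\<lambda>x. u x + f x) S \<and> (\<forall>x\<in>S. u x + f x \<in> u ` S \<or> u x + f x > a)"
  using assms
proof (induction P arbitrary: c rule: finite_induct)
  case empty
  then show ?case by simp
next
  case (insert x P)
  \<comment> \<open>Either x alone already jumps beyond a, or the chain for the remaining elements
    starts at \<open>c + f x\<close>, which is above c because \<open>f x\<close> is
    positive.\<close>
  have fx: "f x \<ge> 1" using insert.prems by simp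
  show ?case
  proof (cases "c + f x > a")
    case True
    then show ?thesis
      using insert.prems by (intro exI[of _ "{x}"] exI[of _ "\<lambda>_. c"]) auto
  next
    case False
    then obtain S u where S: "S \<subseteq> P" "inj_on u S" "u ` S \<subseteq> {c + f x..a}" "c + f x \<in> u ` S"
      "inj_on (\<lambda>x. u x + f x) S" "\<forall>x\<in>S. u x + f x \<in> u ` S \<or> u x + f x > a"
      using insert.IH[of "c + f x"] insert.prems insert.hyps by (auto simp: add.assoc)
    have xS: "x \<notin> S" using S insert.hyps by auto
    define u' where "u' = u(x := c)"
    have u': "u' y = u y" if "y \<in> S" for y using that xS by (auto simp: u'_def)
    have im: "u' ` S = u ` S" using u' by (simp cong: image_cong)
    have im': "u' ` insert x S = insert c (u ` S)" by (simp add: im) (simp add: u'_def)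
    have less: "c + f x \<le> u y" if "y \<in> S" for y using S(3) that by auto
    have pos: "f y \<ge> 1" if "y \<in> S" for y using insert.prems S that by blast
    show ?thesis
    proof (intro exI[of _ "insert x S"] exI[of _ u'] conjI)
      show "insert x S \<subseteq> insert x P" using S by auto
      have "inj_on u' S" using S(2) u' by (simp cong: inj_on_cong)
      moreover have "u' x \<notin> u' ` S"
      proof
        assume "u' x \<in> u' ` S"
        then obtain y where "y \<in> S" "c = u y" unfolding im by (auto simp: u'_def)
        then show False using less[of y] fx by simp
      qed
      ultimately show "inj_on u' (insert x S)" using xS by simp
      show "u' ` insert x S \<subseteq> {c..a}" "c \<in> u' ` insert x S"
        unfolding im' using S(3) insert.prems by auto
      have "inj_on (\<lambda>x. u' x + f x) S" using S(5) u' by (simp cong: inj_on_cong)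
      moreover have "u' x + f x \<notin> (\<lambda>x. u' x + f x) ` S"
      proof
        assume "u' x + f x \<in> (\<lambda>x. u' x + f x) ` S"
        then obtain y where "y \<in> S" "c + f x = u' y + f y" by (auto simp: u'_def)
        then show False using less[of y] pos[of y] u'[of y] by simp
      qed
      ultimately show "inj_on (\<lambda>x. u' x + f x) (insert x S)" using xS by simp
      show "\<forall>y\<in>insert x S. u' y + f y \<in> u' ` insert x S \<or> u' y + f y > a"
        unfolding im' using S(4,6) u' by (auto simp: u'_def)
    qed
  qed
qed

text \<open>A strictly increasing rank plus a weakly increasing summand is strictly increasing; this
  is why ranks are sorted by d.\<close>

lemma inj_on_add_sorted:
  fixes g f :: "'a \<Rightarrow> nat"
  assumes "inj_on g S" and "\<And>x y. x \<in> S \<Longrightarrow> y \<in> S \<Longrightarrow> g x < g y \<Longrightarrow> f x \<le> f y"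
  shows "inj_on (\<lambda>x. g x + f x) S"
proof (rule inj_onI)
  fix x y assume "x \<in> S" "y \<in> S" "g x + f x = g y + f y"
  then show "x = y"
    using assms(2)[of x y] assms(2)[of y x] inj_onD[OF assms(1), of x y]
    by (cases "g x" "g y" rule: linorder_cases) auto
qed

subsection \<open>The half graph colouring\<close>

context split_graph
begin

text \<open>Red degrees are \<open>card A - 1 + u x + d x\<close> on A and
  \<open>card A - w x\<close> on B; blue degrees are \<open>card B - u x\<close> on A and
  \<open>card B - 1 + w x + d x\<close> on B. Conflicts within A or B are excluded by injectivity.
  Across, blue degrees never collide on a blue edge, and red ones only if \<open>u x = 1\<close> and
  \<open>d x = 0\<close>, which \<open>u_min\<close> forbids. The remaining assumption
  \<open>w_min\<close> handles an outer vertex that is blue to all of B.\<close>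

lemma half_graph_colouring:
  fixes u w :: "'a \<Rightarrow> nat"
  assumes X: "X = A \<union> B" "A \<inter> B = {}"
    and card: "card A \<le> card B" "card B \<le> card A + 1" "card A \<ge> 1"
    and u: "bij_betw u A {1..card A}"
    and w: "bij_betw w B {0..<card B}"
    and inj_u: "inj_on (\<lambda>x. u x + d x) A"
    and inj_w: "inj_on (\<lambda>x. w x + d x) B"
    and u_min: "\<And>x. x \<in> A \<Longrightarrow> u x = 1 \<Longrightarrow> d x \<ge> 1"
    and w_min: "\<And>z y. z \<in> B \<Longrightarrow> w z = 0 \<Longrightarrow> d z = 1 \<Longrightarrow> y \<in> V - X \<Longrightarrow> z \<in> N y \<Longrightarrow> \<not> B \<subseteq> N y"
  shows "\<exists>c. irr_decomp E 2 c"
proof -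
  define R where "R x x' \<longleftrightarrow> x \<in> A \<and> x' \<in> A \<or> x \<in> A \<and> x' \<in> B \<and> w x' < u x
    \<or> x \<in> B \<and> x' \<in> A \<and> w x < u x'" for x x'
  have fin: "finite A" "finite B"
    using X finite_X by auto
  have u_le: "1 \<le> u x" "u x \<le> card A" if "x \<in> A" for x
    using u that by (auto simp: bij_betw_def)
  have w_le: "w x < card B" if "x \<in> B" for x
    using w that by (auto simp: bij_betw_def)
  have uA: "card {x'\<in>A. k < u x'} = card A - k" for k
  proof -
    have "{t\<in>{1..card A}. k < t} = {Suc k..card A}" by auto
    then show ?thesis using card_bij_betw_Collect[OF u, of "\<lambda>t. k < t"] by simp
  qed
  have uA': "card {x'\<in>A. u x' \<le> k} = min k (card A)" for k
  proof -
    have "{t\<in>{1..card A}. t \<le> k} = {1..min k (card A)}" by auto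
    then show ?thesis using card_bij_betw_Collect[OF u, of "\<lambda>t. t \<le> k"] by simp
  qed
  have wB: "card {x'\<in>B. w x' < k} = min k (card B)" for k
  proof -
    have "{t\<in>{0..<card B}. t < k} = {0..<min k (card B)}" by auto
    then show ?thesis using card_bij_betw_Collect[OF w, of "\<lambda>t. t < k"] by simp
  qed
  have wB': "card {x'\<in>B. k \<le> w x'} = card B - k" for k
  proof -
    have "{t\<in>{0..<card B}. k \<le> t} = {k..<card B}" by auto
    then show ?thesis using card_bij_betw_Collect[OF w, of "\<lambda>t. k \<le> t"] by simp
  qed
  define r where "r x = (if x \<in> A then card A - 1 + u x + d x else card A - w x)" for x
  define b where "b x = (if x \<in> A then card B - u x else card B - 1 + w x + d x)" for x
  have red_A: "card {x'\<in>X - {x}. R x x'} = card A - 1 + u x" if x: "x \<in> A" for x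
  proof -
    have "{x'\<in>X - {x}. R x x'} = (A - {x}) \<union> {x'\<in>B. w x' < u x}"
      using x X by (auto simp: R_def)
    also have "card \<dots> = card (A - {x}) + card {x'\<in>B. w x' < u x}"
      using fin X by (intro card_Un_disjoint) auto
    finally show ?thesis using x wB u_le[OF x] card fin by simp
  qed
  have red_B: "card {x'\<in>X - {x}. R x x'} = card A - w x" if x: "x \<in> B" for x
  proof -
    have "{x'\<in>X - {x}. R x x'} = {x'\<in>A. w x < u x'}"
      using x X by (auto simp: R_def)
    then show ?thesis using uA by simp
  qed
  have blue_A: "card {x'\<in>X - {x}. \<not> R x x'} = card B - u x" if x: "x \<in> A" for x
  proof -
    have "{x'\<in>X - {x}. \<not> R x x'} = {x'\<in>B. u x \<le> w x'}"
      using x X by (auto simp: R_def)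
    then show ?thesis using wB' by simp
  qed
  have blue_B: "card {x'\<in>X - {x}. \<not> R x x'} = card B - 1 + w x" if x: "x \<in> B" for x
  proof -
    have "{x'\<in>X - {x}. \<not> R x x'} = (B - {x}) \<union> {x'\<in>A. u x' \<le> w x}"
      using x X by (auto simp: R_def)
    also have "card \<dots> = card (B - {x}) + card {x'\<in>A. u x' \<le> w x}"
      using fin X by (intro card_Un_disjoint) auto
    finally show ?thesis using x uA' w_le[OF x] card fin by simp
  qed
  have red_AB: "r x \<noteq> r x'" if "x \<in> A" "x' \<in> B" "w x' < u x" for x x'
  proof
    assume "r x = r x'"
    moreover have "x' \<notin> A" using that X by auto
    ultimately have "card A - 1 + u x + d x = card A - w x'"
      using that by (simp add: r_def)
    then have "u x = 1" "d x = 0"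
      using card u_le[OF that(1)] by linarith+
    then show False using u_min[OF that(1)] by simp
  qed
  have blue_AB: "b x \<noteq> b x'" if "x \<in> A" "x' \<in> B" "u x \<le> w x'" for x x'
  proof
    assume "b x = b x'"
    moreover have "x' \<notin> A" using that X by auto
    ultimately have "card B - u x = card B - 1 + w x' + d x'"
      using that by (simp add: b_def)
    then show False
      using card u_le[OF that(1)] that(3) by linarith
  qed
  show ?thesis
  proof (rule two_colouring[where R = R and A = A and r = r and b = b])
    show "R x x' \<longleftrightarrow> R x' x" for x x' by (auto simp: R_def)
    show "A \<subseteq> X" using X by simp
    show "r x = card {x'\<in>X - {x}. R x x'} + (if x \<in> A then d x else 0)" if "x \<in> X" for x
      using that X red_A[of x] red_B[of x] by (auto simp: r_def)
    show "b x = card {x'\<in>X - {x}. \<not> R x x'} + (if x \<in> A then 0 else d x)" if "x \<in> X" for x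
      using that X blue_A[of x] blue_B[of x] by (auto simp: b_def)
    show "r x \<noteq> r x'" if x: "x \<in> X" "x' \<in> X" "x \<noteq> x'" "R x x'" for x x'
    proof (cases "x \<in> A \<and> x' \<in> A")
      case True
      then show ?thesis using inj_onD[OF inj_u, of x x'] x(3) by (auto simp: r_def)
    next
      case False
      then show ?thesis using x red_AB[of x x'] red_AB[of x' x] by (auto simp: R_def)
    qed
    show "b x \<noteq> b x'" if x: "x \<in> X" "x' \<in> X" "x \<noteq> x'" "\<not> R x x'" for x x'
    proof (cases "x \<in> B \<and> x' \<in> B")
      case True
      then have "x \<notin> A" "x' \<notin> A" using X by auto
      then show ?thesis using True inj_onD[OF inj_w, of x x'] x(3) by (auto simp: b_def)
    next
      case False
      then show ?thesis using x X blue_AB[of x x'] blue_AB[of x' x] by (auto simp: R_def not_less)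
    qed
    show "card (N y \<inter> A) \<noteq> r x" if x: "x \<in> A" "y \<in> V - X" "x \<in> N y" for x y
    proof -
      have "card (N y \<inter> A) \<le> card A" using fin by (simp add: card_mono)
      moreover have "r x = card A - 1 + u x + d x" using x by (simp add: r_def)
      ultimately show ?thesis
        using d_pos[OF x(3,2)] u_le[OF x(1)] card by linarith
    qed
    show "card (N y - A) \<noteq> b x" if x: "x \<in> X - A" "y \<in> V - X" "x \<in> N y" for x y
    proof
      assume eq: "card (N y - A) = b x"
      have sub: "N y - A \<subseteq> B" using N_stable[OF x(2)] X by auto
      then have le: "card (N y - A) \<le> card B" using fin by (simp add: card_mono)
      have bx: "b x = card B - 1 + w x + d x" "x \<in> B" using x X by (auto simp: b_def)
      \<comment> \<open>The left side is at most \<open>card B\<close>, and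
        \<open>d x \<ge> 1\<close>, so equality leaves only this extreme case.\<close>
      then have *: "w x = 0" "d x = 1" "card (N y - A) = card B"
        using eq le d_pos[OF x(3,2)] card by linarith+
      then have "N y - A = B" using sub fin by (simp add: card_subset_eq)
      then show False using w_min[OF bx(2) *(1,2) x(2,3)] by auto
    qed
  qed
qed

text \<open>The part B of the half graph has one vertex that is red to all of A. A vertex z of minimal d
  is forced into that role by the sorting key, and a vertex missed by its only neighbour outside
  the clique is kept in B as well.\<close>

lemma many_attached_colouring:
  assumes n: "card X = n" "n \<ge> 4"
    and many: "card {x\<in>X. d x \<ge> 1} \<ge> n div 2"
    and maximal: "\<And>y. y \<in> V - X \<Longrightarrow> \<not> X \<subseteq> N y"
  shows "\<exists>c. irr_decomp E 2 c"
proof -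
  have "X \<noteq> {}" using n by auto
  define z where "z = arg_min_on d X"
  have z: "z \<in> X" "\<And>x. x \<in> X \<Longrightarrow> d z \<le> d x"
    unfolding z_def using arg_min_if_finite[OF finite_X \<open>X \<noteq> {}\<close>, of d]
    by (auto simp: not_less)
  \<comment> \<open>If \<open>d z = 1\<close>, maximality yields a clique vertex missed by the only
    outer neighbour of z. Otherwise \<open>x0 = z\<close> is a default.\<close>
  obtain x0 where x0: "x0 \<in> X" "d z = 0 \<Longrightarrow> x0 = z"
    "\<And>y. y \<in> V - X \<Longrightarrow> z \<in> N y \<Longrightarrow> d z = 1 \<Longrightarrow> x0 \<notin> N y"
  proof (cases "d z = 1")
    case True
    then obtain y0 where y0: "N z \<inter> (V - X) = {y0}"
      unfolding d_def by (auto simp: card_1_singleton_iff)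
    then obtain x where "x \<in> X" "x \<notin> N y0" using maximal[of y0] by auto
    moreover have "y = y0" if "y \<in> V - X" "z \<in> N y" for y
      using y0 that neighbors_sym[of z E y] by auto
    ultimately show ?thesis using that[of x] True by auto
  next
    case False
    then show ?thesis using that[of z] z by auto
  qed
  define P where "P = {x\<in>X. d x \<ge> 1}"
  have finP: "finite P" using finite_X by (simp add: P_def)
  \<comment> \<open>If \<open>d z = 0\<close>, neither vertex lies in \<open>P\<close>. Otherwise
    \<open>P = X\<close> by minimality of \<open>d z\<close>, and
    \<open>n - 2 \<ge> n div 2\<close>.\<close>
  have "card (P - {z, x0}) \<ge> n div 2"
  proof (cases "d z = 0")
    case True
    then have "P - {z, x0} = P" using x0 by (auto simp: P_def)
    then show ?thesis using many by (simp add: P_def)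
  next
    case False
    then have "P = X" using z by (force simp: P_def)
    then have "card (P - {z, x0}) \<ge> n - card {z, x0}"
      using n diff_card_le_card_Diff[of "{z, x0}" P] by simp
    moreover have "card {z, x0} \<le> 2" by (simp add: card_insert_if)
    ultimately show ?thesis using n by linarith
  qed
  then obtain A where A: "A \<subseteq> P - {z, x0}" "card A = n div 2"
    using obtain_subset_with_card_n by metis
  define B where "B = X - A"
  have AX: "A \<subseteq> X" using A by (auto simp: P_def)
  have cB: "card B = n - n div 2"
    unfolding B_def using AX A n finite_X by (simp add: card_Diff_subset finite_subset)
  have finA: "finite A" "finite B" using AX finite_X by (auto simp: B_def finite_subset)
  obtain u0 where u0: "bij_betw u0 A {0..<card A}"
    "\<forall>x\<in>A. \<forall>y\<in>A. u0 x < u0 y \<longrightarrow> d x \<le> d y"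
    using ex_bij_betw_sorted[OF finA(1)] by blast
  define u where "u x = Suc (u0 x)" for x
  have u: "bij_betw u A {1..card A}"
  proof -
    have "bij_betw Suc {0..<card A} {1..card A}"
      by (rule bij_betw_imageI) (auto simp: image_Suc_atLeastLessThan atLeastLessThanSuc_atLeastAtMost)
    then have "bij_betw (Suc \<circ> u0) A {1..card A}" by (rule bij_betw_trans[OF u0(1)])
    then show ?thesis by (simp add: u_def comp_def cong: bij_betw_cong)
  qed
  \<comment> \<open>The key 0 puts z before every other vertex of B with positive d, and by
    minimality of \<open>d z\<close> the order stays compatible with d. Hence a vertex of rank 0
    with \<open>d x = 1\<close> can only be z.\<close>
  define f where "f x = (if x = z then 0 else d x)" for x
  obtain w where w: "bij_betw w B {0..<card B}"
    "\<forall>x\<in>B. \<forall>y\<in>B. w x < w y \<longrightarrow> f x \<le> f y"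
    using ex_bij_betw_sorted[OF finA(2)] by blast
  have zB: "z \<in> B" "x0 \<in> B" using A z x0 by (auto simp: B_def)
  have w_sorted: "d x \<le> d y" if "x \<in> B" "y \<in> B" "w x < w y" for x y
  proof -
    have "f x \<le> f y" using w that by blast
    then show ?thesis using z(2)[of x] z(2)[of y] that
      by (auto simp: f_def B_def split: if_splits)
  qed
  show ?thesis
  proof (rule half_graph_colouring[where A = A and B = B and u = u and w = w])
    show "X = A \<union> B" "A \<inter> B = {}" using AX by (auto simp: B_def)
    show "card A \<le> card B" "card B \<le> card A + 1" "card A \<ge> 1"
      using A cB n by linarith+
    show "inj_on (\<lambda>x. u x + d x) A"
      by (rule inj_on_add_sorted) (use u0 in \<open>auto simp: bij_betw_def u_def inj_on_def\<close>)
    show "inj_on (\<lambda>x. w x + d x) B"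
      using bij_betw_imp_inj_on[OF w(1)] w_sorted by (rule inj_on_add_sorted)
    show "d x \<ge> 1" if "x \<in> A" for x using that A(1) by (auto simp: P_def)
    show "\<not> B \<subseteq> N y" if y: "x \<in> B" "w x = 0" "d x = 1" "y \<in> V - X" "x \<in> N y" for x y
    proof -
      have "x = z"
      proof (rule ccontr)
        assume "x \<noteq> z"
        then have "w x \<noteq> w z" using inj_onD[OF bij_betw_imp_inj_on[OF w(1)], of x z] y zB by blast
        then have "f x \<le> f z" using w(2)[rule_format, of x z] y zB by simp
        then show False using y \<open>x \<noteq> z\<close> by (simp add: f_def)
      qed
      then show ?thesis using x0(3)[of y] y zB by auto
    qed
  qed (fact u, fact w(1))
qed

text \<open>The chain from \<open>greedy_chain\<close> uses rank 1, as \<open>u_min\<close>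
  requires. Its shifted values are chain ranks again or exceed \<open>card A\<close>, so vertices
  with d = 0 can take all other ranks up to \<open>card A\<close> without a collision.\<close>

lemma heavy_colouring:
  assumes n: "card X = n" "n \<ge> 2"
    and few: "card {x\<in>X. d x \<ge> 1} < n div 2"
    and heavy: "sum d X \<ge> n div 2"
  shows "\<exists>c. irr_decomp E 2 c"
proof -
  define a where "a = n div 2"
  define P where "P = {x\<in>X. d x \<ge> 1}"
  have finP: "finite P" using finite_X by (simp add: P_def)
  have "sum d P = sum d X"
    by (rule sum.mono_neutral_left) (use finite_X in \<open>auto simp: P_def\<close>)
  then have a: "1 \<le> a" "1 + sum d P > a"
    using heavy n by (simp_all add: a_def)
  have pos: "d x \<ge> 1" if "x \<in> P" for x using that by (simp add: P_def)
  from greedy_chain[of P d, OF finP pos a]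
  obtain S u0 where S: "S \<subseteq> P" "inj_on u0 S" "u0 ` S \<subseteq> {1..a}" "1 \<in> u0 ` S"
      "inj_on (\<lambda>x. u0 x + d x) S" "\<forall>x\<in>S. u0 x + d x \<in> u0 ` S \<or> u0 x + d x > a"
    by blast
  have finS: "finite S" using S finP finite_subset by blast
  have cS: "card S \<le> a"
    using S card_mono[of "{1..a}" "u0 ` S"] by (simp add: card_image)
  have cPX: "card (X - P) = n - card P"
    using n finP by (subst card_Diff_subset) (auto simp: P_def)
  \<comment> \<open>By \<open>few\<close> there are more vertices with d = 0 than gaps to fill, so
    at least one of them is left for B.\<close>
  have "a - card S \<le> card (X - P)" "card (X - P) > a - card S"
    using cPX few n cS by (auto simp: a_def P_def)
  then obtain Z where Z: "Z \<subseteq> X - P" "card Z = a - card S" "finite Z"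
    using obtain_subset_with_card_n[of "a - card S" "X - P"] by metis
  have "card ({1..a} - u0 ` S) = a - card S"
    using S finS by (subst card_Diff_subset) (auto simp: card_image)
  then obtain u1 where u1: "bij_betw u1 Z ({1..a} - u0 ` S)"
    using finite_same_card_bij[of Z "{1..a} - u0 ` S"] Z by auto
  define A where "A = S \<union> Z"
  define B where "B = X - A"
  have SZ: "S \<inter> Z = {}" using S Z by auto
  have AX: "A \<subseteq> X" using S Z by (auto simp: A_def P_def)
  have cA: "card A = a" using SZ Z finS cS by (simp add: A_def card_Un_disjoint)
  have finA: "finite A" "finite B" using AX finite_X by (auto simp: B_def finite_subset)
  have cB: "card B = n - a"
    unfolding B_def using AX cA n finA by (simp add: card_Diff_subset)
  define u where "u x = (if x \<in> S then u0 x else u1 x)" for x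
  have uS: "u x = u0 x" if "x \<in> S" for x using that by (simp add: u_def)
  have uZ: "u x = u1 x" if "x \<in> Z" for x using that SZ by (auto simp: u_def)
  have u: "bij_betw u A {1..card A}"
  proof -
    have "bij_betw u S (u0 ` S)"
      using S(2) uS by (simp add: bij_betw_def cong: inj_on_cong image_cong)
    moreover have "bij_betw u Z ({1..a} - u0 ` S)"
      using u1 uZ by (metis (no_types, lifting) bij_betw_cong)
    ultimately have "bij_betw u A (u0 ` S \<union> ({1..a} - u0 ` S))"
      unfolding A_def by (rule bij_betw_combine) auto
    then show ?thesis using S(3) cA by (simp add: Un_absorb1)
  qed
  have dZ: "d x = 0" if "x \<in> Z" for x using that Z by (auto simp: P_def)
  have u1Z: "u1 x \<notin> u0 ` S" "u1 x \<le> a" if "x \<in> Z" for x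
    using u1 that by (auto simp: bij_betw_def)
  obtain w where w: "bij_betw w B {0..<card B}"
    "\<forall>x\<in>B. \<forall>y\<in>B. w x < w y \<longrightarrow> d x \<le> d y"
    using ex_bij_betw_sorted[OF finA(2)] by blast
  \<comment> \<open>Since B contains a vertex with d = 0, sorting gives rank 0 in B to such a
    vertex, and \<open>w_min\<close> holds vacuously.\<close>
  have "Z \<subset> X - P" using Z \<open>card (X - P) > a - card S\<close> by auto
  then obtain z where z: "z \<in> B" "d z = 0"
    using S(1) by (fastforce simp: B_def A_def P_def)
  have disj: "u0 x + d x \<noteq> u1 y" if "x \<in> S" "y \<in> Z" for x y
    using S(6) u1Z[OF that(2)] that by (metis not_less)
  show ?thesis
  proof (rule half_graph_colouring[where A = A and B = B and u = u and w = w])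
    show "X = A \<union> B" "A \<inter> B = {}" using AX by (auto simp: B_def)
    show "card A \<le> card B" "card B \<le> card A + 1" "card A \<ge> 1"
      using cA cB n by (auto simp: a_def)
    show "inj_on (\<lambda>x. u x + d x) A"
    proof (rule inj_onI)
      fix x y assume xy: "x \<in> A" "y \<in> A" "u x + d x = u y + d y"
      consider "x \<in> S" "y \<in> S" | "x \<in> S" "y \<in> Z" | "x \<in> Z" "y \<in> S" | "x \<in> Z" "y \<in> Z"
        using xy by (auto simp: A_def)
      then show "x = y"
      proof cases
        case 1 then show ?thesis using xy inj_onD[OF S(5), of x y] by (simp add: uS)
      next
        case 2 then show ?thesis using xy disj[of x y] by (simp add: uS uZ dZ)
      next
        case 3 then show ?thesis using xy disj[of y x] by (simp add: uS uZ dZ)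
      next
        case 4 then show ?thesis using xy u1 by (simp add: uZ dZ bij_betw_def inj_on_def)
      qed
    qed
    show "inj_on (\<lambda>x. w x + d x) B"
      using bij_betw_imp_inj_on[OF w(1)] w(2) by (blast intro: inj_on_add_sorted)
    show "d x \<ge> 1" if "x \<in> A" "u x = 1" for x
    proof -
      have "x \<notin> Z" using that S(4) u1Z(1)[of x] uZ[of x] by metis
      then show ?thesis using that S(1) by (auto simp: A_def P_def)
    qed
    show "\<not> B \<subseteq> N y" if y: "x \<in> B" "w x = 0" "d x = 1" for x y
    proof -
      have "x \<noteq> z" using y z by auto
      then have "w x \<noteq> w z"
        using inj_onD[OF bij_betw_imp_inj_on[OF w(1)], of x z] y z by blast
      then have "d x \<le> d z" using w(2)[rule_format, of x z] y z by simp
      then show ?thesis using y z by simp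
    qed
  qed (fact u, fact w(1))
qed

end

subsection \<open>Few outer edges\<close>

text \<open>Index 0 plays the role of p, index n - 1 that of q. Among the indices 1, ..., n - 2 the base
  graph joins i and j when i + j is at least n - 1, and index 0 is joined to the upper half. This
  gives the degrees 1, ..., n - 2; each further edge at p or q is paid for by deleting an edge
  inside or the edge from 0 to t.\<close>

lemma sparse_pattern_even:
  fixes n h t l :: nat
  assumes n: "n = 2 * h + 2" "h \<ge> 4" and t: "h < t" "t < n - 2" and l: "1 \<le> l" "l \<le> 3"
  shows "\<exists>R. (\<forall>i j. R i j \<longleftrightarrow> R j i) \<and>
    (\<forall>i. 1 \<le> i \<longrightarrow> i \<le> n - 2 \<longrightarrow> card {j. j < n \<and> j \<noteq> i \<and> R i j} = i) \<and>
    card {j. j < n \<and> j \<noteq> 0 \<and> R 0 j} = h \<and>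
    card {j. j < n \<and> j \<noteq> n - 1 \<and> R (n - 1) j} = 4 \<and>
    \<not> R 0 t \<and> R 0 h \<and> \<not> R (n - 1) 4 \<and> R (n - 1) l"
proof -
  \<comment> \<open>Index 0 trades t for h. Then t is compensated by an edge to n - 1, while h loses
    its edge to x, which is compensated in the same way. Likewise l trades n - 2 for n - 1, and n -
    2 gets an edge to n - 1. So x may be any index strictly between h and n - 2 other than
    t.\<close>
  define x where "x = (if t = h + 1 then h + 2 else h + 1)"
  have x: "h < x" "x < n - 2" "x \<noteq> t" using n by (auto simp: x_def)
  define Q where "Q i j \<longleftrightarrow> (if i = 0 then h \<le> j \<and> j \<noteq> n - 1 \<and> j \<noteq> t
    else if j = n - 1 then i \<in> {t, x, n - 2, l}
    else i + j \<ge> n - 1 \<and> \<not> (i = h \<and> j = x) \<and> \<not> (i = l \<and> j = n - 2))" for i j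
  define R where "R i j \<longleftrightarrow> Q (min i j) (max i j)" for i j
  let ?S = "\<lambda>i. {j. j < n \<and> j \<noteq> i \<and> R i j}"
  have R: "R i j \<longleftrightarrow> (if i \<le> j then Q i j else Q j i)" for i j
    by (simp add: R_def min_def max_def)
  have "?S 0 = {h..n - 2} - {t}"
    using n t l x by (auto simp: R Q_def)
  then have S0: "card (?S 0) = h" using n t by simp
  have "?S (n - 1) = {t, x, n - 2, l}"
    using n t l x by (auto simp: R Q_def)
  then have Sn: "card (?S (n - 1)) = 4" using n t l x by simp
  \<comment> \<open>In the upper half the interval of base neighbours contains i itself; the missing
    unit of degree comes from index 0 or, for t, from n - 1.\<close>
  have upper: "card ({n - 1 - i..n - 2} - {i}) = i - 1" if "n - 1 \<le> 2 * i" "i \<le> n - 2" for i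
  proof -
    have "card {n - 1 - i..n - 2} = i"
      unfolding card_atLeastAtMost using that n by linarith
    moreover have "i \<in> {n - 1 - i..n - 2}" using that by auto
    ultimately show ?thesis by (simp add: card_Diff_singleton)
  qed
  have S: "card (?S i) = i" if i: "1 \<le> i" "i \<le> n - 2" for i
  proof -
    consider "i = l" | "i = h" | "i < h" "i \<noteq> l" | "i = t" | "i = x" | "i = n - 2"
      | "h < i" "i < n - 2" "i \<noteq> t" "i \<noteq> x" using i by linarith
    then show ?thesis
    proof cases
      case 1
      then have "?S i = insert (n - 1) {n - 1 - i..n - 3}"
        using n t l x by (auto simp: R Q_def)
      then show ?thesis using n 1 l by simp
    next
      case 2
      then have "?S i = insert 0 ({h + 1..n - 2} - {x})"
        using n t l x by (auto simp: R Q_def)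
      then show ?thesis using n x 2 by simp
    next
      case 3
      then have "?S i = {n - 1 - i..n - 2}"
        using n t l x i by (auto simp: R Q_def)
      then show ?thesis using n i by simp
    next
      case 4
      then have "?S i = insert (n - 1) ({n - 1 - i..n - 2} - {i})"
        using n t l x i by (auto simp: R Q_def)
      then show ?thesis using n t i 4 upper[of i] by simp
    next
      case 5
      then have "?S i = insert 0 (insert (n - 1) ({n - 1 - i..n - 2} - {i, h}))"
        using n t l x i by (auto simp: R Q_def)
      then show ?thesis using n x i 5 by (simp add: card_Diff_subset)
    next
      case 6
      then have "?S i = insert 0 (insert (n - 1) ({1..n - 3} - {l}))"
        using n t l x i by (auto simp: R Q_def)
      then show ?thesis using n l 6 by simp
    next
      case 7
      then have "?S i = insert 0 ({n - 1 - i..n - 2} - {i})"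
        using n t l x i by (auto simp: R Q_def)
      then show ?thesis using n i 7 upper[of i] by simp
    qed
  qed
  have "R i j \<longleftrightarrow> R j i" for i j
    by (simp add: R_def min.commute max.commute)
  moreover have "\<not> R 0 t" "R 0 h" "\<not> R (n - 1) 4" "R (n - 1) l"
    using n t l x by (auto simp: R Q_def)
  ultimately show ?thesis
    using S S0 Sn by blast
qed

text \<open>For odd n the upper half starts at h, so 0 is joined to h from the outset. Index 0
  trades t for n - 1; this edge replaces the one from x as the fourth at n - 1, and no correction at
  h is needed.\<close>

lemma sparse_pattern_odd:
  fixes n h t l :: nat
  assumes n: "n = 2 * h + 1" "h \<ge> 5" and t: "h < t" "t < n - 2" and l: "1 \<le> l" "l \<le> 3"
  shows "\<exists>R. (\<forall>i j. R i j \<longleftrightarrow> R j i) \<and>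
    (\<forall>i. 1 \<le> i \<longrightarrow> i \<le> n - 2 \<longrightarrow> card {j. j < n \<and> j \<noteq> i \<and> R i j} = i) \<and>
    card {j. j < n \<and> j \<noteq> 0 \<and> R 0 j} = h \<and>
    card {j. j < n \<and> j \<noteq> n - 1 \<and> R (n - 1) j} = 4 \<and>
    \<not> R 0 t \<and> R 0 h \<and> \<not> R (n - 1) 4 \<and> R (n - 1) l"
proof -
  define Q where "Q i j \<longleftrightarrow> (if i = 0 then h \<le> j \<and> j \<noteq> t
    else if j = n - 1 then i \<in> {t, n - 2, l}
    else i + j \<ge> n - 1 \<and> \<not> (i = l \<and> j = n - 2))" for i j
  define R where "R i j \<longleftrightarrow> Q (min i j) (max i j)" for i j
  let ?S = "\<lambda>i. {j. j < n \<and> j \<noteq> i \<and> R i j}"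
  have R: "R i j \<longleftrightarrow> (if i \<le> j then Q i j else Q j i)" for i j
    by (simp add: R_def min_def max_def)
  have "?S 0 = {h..n - 1} - {t}"
    using n t l by (auto simp: R Q_def)
  then have S0: "card (?S 0) = h" using n t by simp
  have "?S (n - 1) = {0, t, n - 2, l}"
    using n t l by (auto simp: R Q_def)
  then have Sn: "card (?S (n - 1)) = 4" using n t l by simp
  have upper: "card ({n - 1 - i..n - 2} - {i}) = i - 1" if "n - 1 \<le> 2 * i" "i \<le> n - 2" for i
  proof -
    have "card {n - 1 - i..n - 2} = i"
      unfolding card_atLeastAtMost using that n by linarith
    moreover have "i \<in> {n - 1 - i..n - 2}" using that by auto
    ultimately show ?thesis by (simp add: card_Diff_singleton)
  qed
  have S: "card (?S i) = i" if i: "1 \<le> i" "i \<le> n - 2" for i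
  proof -
    consider "i = l" | "i < h" "i \<noteq> l" | "i = t" | "i = n - 2"
      | "h \<le> i" "i < n - 2" "i \<noteq> t" using i by linarith
    then show ?thesis
    proof cases
      case 1
      then have "?S i = insert (n - 1) {n - 1 - i..n - 3}"
        using n t l by (auto simp: R Q_def)
      then show ?thesis using n 1 l by simp
    next
      case 2
      then have "?S i = {n - 1 - i..n - 2}"
        using n t l i by (auto simp: R Q_def)
      then show ?thesis using n i by simp
    next
      case 3
      then have eq: "?S i = insert (n - 1) ({n - 1 - i..n - 2} - {i})"
        using n t l i by (auto simp: R Q_def)
      show ?thesis
        unfolding eq using n t i 3 upper[of i] by (subst card_insert_disjoint) auto
    next
      case 4
      then have "?S i = insert 0 (insert (n - 1) ({1..n - 3} - {l}))"
        using n t l i by (auto simp: R Q_def)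
      then show ?thesis using n l 4 by simp
    next
      case 5
      then have "?S i = insert 0 ({n - 1 - i..n - 2} - {i})"
        using n t l i by (auto simp: R Q_def)
      then show ?thesis using n i 5 upper[of i] by simp
    qed
  qed
  have "R i j \<longleftrightarrow> R j i" for i j
    by (simp add: R_def min.commute max.commute)
  moreover have "\<not> R 0 t" "R 0 h" "\<not> R (n - 1) 4" "R (n - 1) l"
    using n t l by (auto simp: R Q_def)
  ultimately show ?thesis
    using S S0 Sn by blast
qed

text \<open>An index from 1 to n - 2 equals its degree, so the last four conditions prescribe the
  colour of p or q towards the vertices of critical degree: t and \<open>(n - 1) div 2\<close> for
  p, and 4 and l for q.\<close>

lemma sparse_pattern:
  fixes n t l :: nat
  assumes "n \<ge> 10" and "(n - 1) div 2 < t" "t < n - 2" and "1 \<le> l" "l \<le> 3"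
  obtains R where "\<And>i j. R i j \<longleftrightarrow> R j i"
    and "\<And>i. 1 \<le> i \<Longrightarrow> i \<le> n - 2 \<Longrightarrow> card {j. j < n \<and> j \<noteq> i \<and> R i j} = i"
    and "card {j. j < n \<and> j \<noteq> 0 \<and> R 0 j} = (n - 1) div 2"
    and "card {j. j < n \<and> j \<noteq> n - 1 \<and> R (n - 1) j} = 4"
    and "\<not> R 0 t" "R 0 ((n - 1) div 2)" "\<not> R (n - 1) 4" "R (n - 1) l"
proof (cases "even n")
  case True
  then have n: "n = 2 * ((n - 1) div 2) + 2" using assms(1) by presburger
  have "(n - 1) div 2 \<ge> 4" using assms(1) by linarith
  from sparse_pattern_even[OF n this assms(2-5)] that show ?thesis by blast
next
  case False
  then have n: "n = 2 * ((n - 1) div 2) + 1" using assms(1) by presburger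
  have "(n - 1) div 2 \<ge> 5" using assms(1) n by linarith
  from sparse_pattern_odd[OF n this assms(2-5)] that show ?thesis by blast
qed

context split_graph
begin

text \<open>The vertices other than p and q are numbered by increasing d, and the number is the red
  degree inside X. As the total of d is small, positive d occurs only at numbers above t. All
  vertices up to t therefore have red degree equal to their number, which makes the critical
  vertices for p and q predictable.\<close>

lemma sparse_colouring:
  assumes n: "card X = n" "n \<ge> 10"
    and two: "card {x\<in>X. d x \<ge> 1} \<ge> 2"
    and light: "sum d X < n div 2"
  shows "\<exists>c. irr_decomp E 2 c"
proof -
  obtain p q where pq: "p \<in> X" "q \<in> X" "p \<noteq> q" "d p \<ge> 1" "d q \<ge> 1"
  proof -
    obtain T where "T \<subseteq> {x\<in>X. d x \<ge> 1}" "card T = 2"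
      using obtain_subset_with_card_n[OF two] by metis
    then show ?thesis using that by (auto simp: card_2_iff)
  qed
  define W where "W = X - {p, q}"
  have XW: "X = insert p (insert q W)" "p \<notin> W" "q \<notin> W" using pq by (auto simp: W_def)
  have finW: "finite W" using finite_X by (simp add: W_def)
  have cW: "card W = n - 2"
    unfolding W_def using pq n by (subst card_Diff_subset) auto
  obtain g0 where g0: "bij_betw g0 W {0..<n - 2}"
    and sorted0: "\<forall>x\<in>W. \<forall>y\<in>W. g0 x < g0 y \<longrightarrow> d x \<le> d y"
    using ex_bij_betw_sorted[OF finW, of d] cW by auto
  define g where "g x = (if x = p then 0 else if x = q then n - 1 else Suc (g0 x))" for x
  have gpq: "g p = 0" "g q = n - 1" using pq by (auto simp: g_def)
  have gW: "g x = Suc (g0 x)" if "x \<in> W" for x using that XW by (auto simp: g_def)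
  have g0W: "g0 x < n - 2" if "x \<in> W" for x using g0 that by (auto simp: bij_betw_def)
  have sorted: "d x \<le> d y" if "x \<in> W" "y \<in> W" "g x < g y" for x y
    using sorted0[rule_format, of x y] gW that by simp
  have gW_range: "1 \<le> g x" "g x \<le> n - 2" if "x \<in> W" for x
    using g0W[OF that] gW[OF that] by auto
  have inj_W: "inj_on g W"
    using g0 gW by (auto simp: bij_betw_def inj_on_def)
  have inj: "inj_on g X"
    unfolding XW(1) using inj_W XW gpq gW_range n by (force simp: inj_on_insert)
  have "g ` X \<subseteq> {..<n}" unfolding XW(1) using gpq gW_range n by fastforce
  then have "g ` X = {..<n}"
    using card_subset_eq[of "{..<n}" "g ` X"] card_image[OF inj] n by simp
  then have g: "bij_betw g X {..<n}" using inj by (simp add: bij_betw_def)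

  have sum_X: "sum d X = d p + d q + sum d W"
    using XW finW pq by (simp add: add.assoc)
  define h where "h = (n - 1) div 2"
  define t where "t = h + d p"
  have h: "h \<ge> 4" "n div 2 \<le> h + 1" "h + n div 2 = n - 1" using n by (auto simp: h_def)
  have ht: "h < t" using pq by (simp add: t_def)
  have "t < n - 2" unfolding t_def using pq light sum_X h n by linarith
  with ht have t: "(n - 1) div 2 < t" "t < n - 2" by (simp_all add: h_def)
  \<comment> \<open>With blue outer edges, q has blue degree \<open>n - 5 + d q\<close>, which
    equals that of the vertex numbered \<open>4 - d q\<close>; hence that vertex must be red to q.
    For \<open>d q \<ge> 4\<close> there is none, and 1 is a dummy.\<close>
  have l: "1 \<le> max 1 (4 - d q)" "max 1 (4 - d q) \<le> 3" using pq by auto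
  obtain R where R_sym: "\<And>i j. R i j \<longleftrightarrow> R j i"
    and R_W: "\<And>i. 1 \<le> i \<Longrightarrow> i \<le> n - 2 \<Longrightarrow> card {j. j < n \<and> j \<noteq> i \<and> R i j} = i"
    and R_p: "card {j. j < n \<and> j \<noteq> 0 \<and> R 0 j} = h"
    and R_q: "card {j. j < n \<and> j \<noteq> n - 1 \<and> R (n - 1) j} = 4"
    and R: "\<not> R 0 t" "R 0 h" "\<not> R (n - 1) 4" "R (n - 1) (max 1 (4 - d q))"
    by (rule sparse_pattern[OF n(2) t l, folded h_def], rule that)

  define \<rho> where "\<rho> x = card {x'\<in>X - {x}. R (g x) (g x')}" for x
  have \<rho>: "\<rho> x = card {j. j < n \<and> j \<noteq> g x \<and> R (g x) j}" if "x \<in> X" for x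
  proof -
    have "{x'\<in>X - {x}. R (g x) (g x')} = {x'\<in>X. g x' \<noteq> g x \<and> R (g x) (g x')}"
      using inj that by (auto simp: inj_on_def)
    then show ?thesis
      using card_bij_betw_Collect[OF g, of "\<lambda>j. j \<noteq> g x \<and> R (g x) j"]
      by (simp add: \<rho>_def)
  qed
  have \<rho>_p: "\<rho> p = h" and \<rho>_q: "\<rho> q = 4"
    using \<rho>[OF pq(1)] \<rho>[OF pq(2)] R_p R_q by (simp_all add: gpq)
  have \<rho>_W: "\<rho> x = g x" if "x \<in> W" for x
    using \<rho>[of x] R_W[of "g x"] gW_range[OF that] that by (simp add: W_def)
  have blue: "card {x'\<in>X - {x}. \<not> R (g x) (g x')} = n - 1 - \<rho> x" if "x \<in> X" for x
  proof -
    have "{x'\<in>X - {x}. \<not> R (g x) (g x')} = (X - {x}) - {x'\<in>X - {x}. R (g x) (g x')}"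
      by auto
    also have "card \<dots> = card (X - {x}) - \<rho> x"
      unfolding \<rho>_def using finite_X by (intro card_Diff_subset) auto
    finally show ?thesis using that n finite_X by simp
  qed

  \<comment> \<open>All \<open>n - 1 - g x\<close> vertices numbered from \<open>g x\<close> on have
    positive d, so there are at most \<open>sum d W\<close> of them, and
    \<open>d p + d q + sum d W < n div 2\<close>.\<close>
  have far: "g x > t" if x: "x \<in> W" "d x \<ge> 1" for x
  proof -
    let ?U = "{y\<in>W. g x \<le> g y}"
    have "d y \<ge> 1" if "y \<in> ?U" for y
      using sorted[of x y] inj_onD[OF inj_W, of x y] x that
      by (cases "g x" "g y" rule: linorder_cases) auto
    then have "card ?U \<le> sum d ?U"
      using sum_mono[of ?U "\<lambda>_. 1" d] by simp
    also have "\<dots> \<le> sum d W" using finW by (intro sum_mono2) auto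
    finally have "card ?U + d p + d q < n div 2" using light sum_X by simp
    moreover have "card ?U = n - 1 - g x"
    proof -
      have "?U = {y\<in>W. g0 x \<le> g0 y}" using gW x by auto
      moreover have "{j\<in>{0..<n - 2}. g0 x \<le> j} = {g0 x..<n - 2}" by auto
      ultimately show ?thesis
        using card_bij_betw_Collect[OF g0, of "\<lambda>j. g0 x \<le> j"] gW x by simp
    qed
    ultimately show ?thesis using gW_range[OF x(1)] h pq by (simp add: t_def)
  qed

  \<comment> \<open>Outer edges are blue at q and red at all other clique vertices. Thus p has red
    degree t and blue degree \<open>n - 1 - h\<close>.\<close>
  define A where "A = X - {q}"
  define r where "r x = \<rho> x + (if x \<in> A then d x else 0)" for x
  define b where "b x = n - 1 - \<rho> x + (if x \<in> A then 0 else d x)" for x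
  have r_eq: "r p = t" "r q = 4" "\<And>x. x \<in> W \<Longrightarrow> r x = g x + d x"
    using \<rho>_p \<rho>_q \<rho>_W pq XW by (auto simp: r_def A_def t_def)
  have b_eq: "b p = n - 1 - h" "b q = n - 5 + d q" "\<And>x. x \<in> W \<Longrightarrow> b x = n - 1 - g x"
    using \<rho>_p \<rho>_q \<rho>_W pq XW n by (auto simp: b_def A_def)
  have red_pW: "r p \<noteq> r x" if "x \<in> W" "R 0 (g x)" for x
    using that far[of x] R(1) r_eq by (cases "d x = 0") auto
  have red_qW: "r q \<noteq> r x" if "x \<in> W" "R (n - 1) (g x)" for x
    using that far[of x] R(3) r_eq ht h by (cases "d x = 0") auto
  have blue_pW: "b p \<noteq> b x" if "x \<in> W" "\<not> R 0 (g x)" for x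
  proof
    assume "b p = b x"
    then have "g x = h" using b_eq that gW_range[OF that(1)] h n by simp
    then show False using that R by simp
  qed
  have blue_qW: "b q \<noteq> b x" if "x \<in> W" "\<not> R (n - 1) (g x)" for x
  proof
    assume "b q = b x"
    then have "g x + d q = 4" using b_eq that gW_range[OF that(1)] n by simp
    then have "g x = max 1 (4 - d q)" using gW_range[OF that(1)] by simp
    then show False using that R by simp
  qed
  have inj_gd: "inj_on (\<lambda>x. g x + d x) W"
    using inj_W sorted by (rule inj_on_add_sorted)
  have red_W: "r x \<noteq> r y" if "x \<in> W" "y \<in> W" "x \<noteq> y" for x y
    using inj_onD[OF inj_gd, of x y] that r_eq(3) by auto
  have blue_W: "b x \<noteq> b y" if "x \<in> W" "y \<in> W" "x \<noteq> y" for x y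
  proof
    assume "b x = b y"
    then have "g x = g y"
      using that b_eq(3) gW_range(2)[of x] gW_range(2)[of y] n(2) by simp
    then show False using inj_onD[OF inj_W, of x y] that by simp
  qed
  show ?thesis
  proof (rule two_colouring[where R = "\<lambda>x y. R (g x) (g y)" and A = A and r = r and b = b])
    show "R (g x) (g y) \<longleftrightarrow> R (g y) (g x)" for x y by (rule R_sym)
    show "A \<subseteq> X" by (auto simp: A_def)
    show "r x = card {x'\<in>X - {x}. R (g x) (g x')} + (if x \<in> A then d x else 0)" for x
      by (simp add: r_def \<rho>_def)
    show "b x = card {x'\<in>X - {x}. \<not> R (g x) (g x')} + (if x \<in> A then 0 else d x)" if "x \<in> X" for x
      using blue[OF that] by (simp add: b_def)
    show "r x \<noteq> r y" if xy: "x \<in> X" "y \<in> X" "x \<noteq> y" "R (g x) (g y)" for x y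
    proof -
      have "r p \<noteq> r q" using r_eq ht h by simp
      then show ?thesis
        using xy red_W[of x y] red_pW[of x] red_pW[of y] red_qW[of x] red_qW[of y]
          R_sym[of "g x" "g y"] unfolding XW(1) by (auto simp: gpq)
    qed
    show "b x \<noteq> b y" if xy: "x \<in> X" "y \<in> X" "x \<noteq> y" "\<not> R (g x) (g y)" for x y
    proof -
      have "b p \<noteq> b q" using b_eq h pq n by simp
      then show ?thesis
        using xy blue_W[of x y] blue_pW[of x] blue_pW[of y] blue_qW[of x] blue_qW[of y]
          R_sym[of "g x" "g y"] unfolding XW(1) by (auto simp: gpq)
    qed
    show "card (N y \<inter> A) \<noteq> r x" if xy: "x \<in> A" "y \<in> V - X" "x \<in> N y" for x y
    proof -
      \<comment> \<open>Each neighbour of y contributes at least 1 to the total of d, so y has fewer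
        than h red edges, whereas clique vertices in A with outer edges have red degree above
        h.\<close>
      have "card (N y \<inter> A) \<le> sum d (N y \<inter> A)"
        using sum_mono[of "N y \<inter> A" "\<lambda>_. 1" d] d_pos[OF _ xy(2)] by simp
      also have "\<dots> \<le> sum d A" using finite_X by (intro sum_mono2) (auto simp: A_def)
      also have "sum d A + d q = sum d X"
        using finite_X pq by (simp add: A_def sum.remove[of X q])
      finally have "card (N y \<inter> A) < h" using light pq h by linarith
      moreover have "r x > h"
        using xy ht r_eq far[of x] d_pos[OF xy(3,2)] by (cases "x = p") (auto simp: A_def W_def)
      ultimately show ?thesis by simp
    qed
    show "card (N y - A) \<noteq> b x" if xy: "x \<in> X - A" "y \<in> V - X" "x \<in> N y" for x y
    proof -
      have "N y - A \<subseteq> {q}" using N_stable[OF xy(2)] by (auto simp: A_def)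
      then have "card (N y - A) \<le> 1" using card_mono[of "{q}" "N y - A"] by simp
      moreover have "x = q" using xy by (auto simp: A_def)
      ultimately show ?thesis using b_eq n by simp
    qed
  qed
qed

end

subsection \<open>One vertex with outer edges\<close>

text \<open>The ranges are the largest \<open>n div 2\<close> numbers in \<open>{1..n - 1}\<close>
  and the rest; Gauss's formula and a parity split give the surplus needed for the double counting
  of degrees.\<close>

lemma sum_upper_half:
  assumes "n \<ge> 1"
  shows "(\<Sum>k\<in>{n - n div 2..n - 1}. int k) - (\<Sum>k\<in>{1..<n - n div 2}. int k) = int (n div 2) ^ 2"
proof -
  have gauss: "2 * (\<Sum>k\<in>{1..<m}. int k) = int m * (int m - 1)" if "m \<ge> 1" for m
    using that by (induction m rule: dec_induct) (simp_all add: algebra_simps)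
  have "{1..<n} = {1..<n - n div 2} \<union> {n - n div 2..n - 1}"
    using assms by auto
  then have "(\<Sum>k\<in>{1..<n}. int k) =
      (\<Sum>k\<in>{1..<n - n div 2}. int k) + (\<Sum>k\<in>{n - n div 2..n - 1}. int k)"
    by (simp only:) (rule sum.union_disjoint; auto)
  moreover have "2 * (\<Sum>k\<in>{1..<n}. int k) = int n * (int n - 1)"
    by (rule gauss[OF assms])
  moreover have "2 * (\<Sum>k\<in>{1..<n - n div 2}. int k) = int (n - n div 2) * (int (n - n div 2) - 1)"
    by (rule gauss) (use assms in linarith)
  moreover have "int n * (int n - 1) - 2 * (int (n - n div 2) * (int (n - n div 2) - 1)) =
      2 * int (n div 2) ^ 2"
  proof (cases "even n")
    case True
    then obtain m where "n = 2 * m" by auto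
    then show ?thesis by (simp add: algebra_simps power2_eq_square)
  next
    case False
    then obtain m where "n = 2 * m + 1" by (auto elim: oddE)
    then show ?thesis by (simp add: algebra_simps power2_eq_square)
  qed
  ultimately show ?thesis by linarith
qed

text \<open>The upper half A of the degree sequence exceeds the lower half in sum by card A squared. Of this,
  edges inside A account for at most card A * (card A - 1), so the edges to v must account for the
  rest.\<close>

lemma distinct_degrees_threshold:
  fixes R :: "'a \<Rightarrow> 'a \<Rightarrow> bool"
  assumes W: "finite W" "v \<notin> W" and n: "n \<ge> 1"
    and sym: "\<And>x y. R x y \<longleftrightarrow> R y x"
    and \<rho>: "\<And>x. x \<in> W \<Longrightarrow> \<rho> x = card {y \<in> insert v W - {x}. R x y}"
    and bij: "bij_betw \<rho> W {1..n - 1}"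
    and x: "x \<in> W"
  shows "R x v \<longleftrightarrow> n \<le> 2 * \<rho> x"
proof -
  define A where "A = {x\<in>W. n \<le> 2 * \<rho> x}"
  define B where "B = {x\<in>W. \<not> n \<le> 2 * \<rho> x}"
  have AB: "finite A" "finite B" "A \<inter> B = {}" "W = A \<union> B" "v \<notin> A" "v \<notin> B"
    using W by (auto simp: A_def B_def)
  \<comment> \<open>The adjacency matrix with zero diagonal, since \<open>R x x\<close> is
    unrestricted; integer entries allow subtraction.\<close>
  define M :: "'a \<Rightarrow> 'a \<Rightarrow> int" where "M x y = of_bool (x \<noteq> y \<and> R x y)" for x y
  have M_sym: "M x y = M y x" for x y using sym[of x y] by (auto simp: M_def)
  have \<rho>_M: "int (\<rho> x) = sum (M x) A + sum (M x) B + M x v" if "x \<in> W" for x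
  proof -
    have "{y \<in> insert v W - {x}. R x y} = {y \<in> insert v W. x \<noteq> y \<and> R x y}" by auto
    then have "int (\<rho> x) = sum (M x) (insert v W)"
      using \<rho>[OF that] W(1) by (simp add: M_def sum.If_cases Int_def)
    also have "\<dots> = M x v + (sum (M x) A + sum (M x) B)"
      using AB by (simp add: sum.union_disjoint)
    finally show ?thesis by simp
  qed
  have img: "\<rho> ` A = {n - n div 2..n - 1}" "\<rho> ` B = {1..<n - n div 2}"
  proof -
    have "\<rho> ` A = {k\<in>\<rho> ` W. n \<le> 2 * k}" "\<rho> ` B = {k\<in>\<rho> ` W. \<not> n \<le> 2 * k}"
      by (auto simp: A_def B_def)
    moreover have "\<rho> ` W = {1..n - 1}" using bij by (simp add: bij_betw_def)
    moreover have "{k\<in>{1..n - 1}. n \<le> 2 * k} = {n - n div 2..n - 1}"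
      "{k\<in>{1..n - 1}. \<not> n \<le> 2 * k} = {1..<n - n div 2}"
      using n by auto
    ultimately show "\<rho> ` A = {n - n div 2..n - 1}" "\<rho> ` B = {1..<n - n div 2}" by simp_all
  qed
  have inj: "inj_on \<rho> A" "inj_on \<rho> B"
    using bij by (auto simp: bij_betw_def A_def B_def inj_on_def)
  have sum_diff: "(\<Sum>x\<in>A. int (\<rho> x)) - (\<Sum>x\<in>B. int (\<rho> x)) = int (n div 2) ^ 2"
    using sum_upper_half[OF n] sum.reindex[OF inj(1), of int] sum.reindex[OF inj(2), of int]
    by (simp add: img)
  have cA: "card A = n div 2" using card_image[OF inj(1)] img n by simp
  have inner: "sum (M x) A \<le> int (card A) - 1" if "x \<in> A" for x
  proof -
    have "sum (M x) A = sum (M x) (A - {x})"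
      by (rule sum.mono_neutral_right) (use AB in \<open>auto simp: M_def\<close>)
    also have "\<dots> \<le> (\<Sum>y\<in>A - {x}. 1)" by (rule sum_mono) (simp add: M_def)
    also have "\<dots> = int (card A) - 1"
      using that AB card_gt_0_iff[of A] by (auto simp: of_nat_diff)
    finally show ?thesis .
  qed
  have "(\<Sum>x\<in>A. sum (M x) A) \<le> (\<Sum>x\<in>A. int (card A) - 1)"
    by (rule sum_mono) (rule inner)
  then have AA: "(\<Sum>x\<in>A. sum (M x) A) \<le> int (card A) * (int (card A) - 1)" by simp
  \<comment> \<open>Edges between A and B contribute equally to both degree sums and cancel in the
    difference.\<close>
  have swap: "(\<Sum>x\<in>B. sum (M x) A) = (\<Sum>x\<in>A. sum (M x) B)"
    using sum.swap[of M A B] M_sym by simp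
  have nonneg: "M x y \<ge> 0" "M x y \<le> 1" for x y by (simp_all add: M_def)
  have "(\<Sum>x\<in>A. int (\<rho> x)) = (\<Sum>x\<in>A. sum (M x) A + sum (M x) B + M x v)"
    by (rule sum.cong) (use AB \<rho>_M in auto)
  then have sA: "(\<Sum>x\<in>A. int (\<rho> x)) =
      (\<Sum>x\<in>A. sum (M x) A) + (\<Sum>x\<in>A. sum (M x) B) + (\<Sum>x\<in>A. M x v)"
    by (simp add: sum.distrib)
  have "(\<Sum>x\<in>B. int (\<rho> x)) = (\<Sum>x\<in>B. sum (M x) A + sum (M x) B + M x v)"
    by (rule sum.cong) (use AB \<rho>_M in auto)
  then have sB: "(\<Sum>x\<in>B. int (\<rho> x)) =
      (\<Sum>x\<in>B. sum (M x) A) + (\<Sum>x\<in>B. sum (M x) B) + (\<Sum>x\<in>B. M x v)"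
    by (simp add: sum.distrib)
  have BB: "(\<Sum>x\<in>B. sum (M x) B) \<ge> 0" and Bv: "(\<Sum>x\<in>B. M x v) \<ge> 0"
    by (intro sum_nonneg nonneg)+
  have Av: "(\<Sum>x\<in>A. 1 - M x v) \<ge> 0"
    by (intro sum_nonneg) (simp add: nonneg)
  have Av_eq: "(\<Sum>x\<in>A. 1 - M x v) = int (card A) - (\<Sum>x\<in>A. M x v)"
    by (simp add: sum_subtractf)
  \<comment> \<open>The upper bound for the difference is attained, so every vertex of A is joined
    to v and no vertex of B is.\<close>
  have "int (card A) ^ 2 = int (card A) * (int (card A) - 1) + int (card A)"
    by (simp add: algebra_simps power2_eq_square)
  then have "(\<Sum>x\<in>A. 1 - M x v) = 0" "(\<Sum>x\<in>B. M x v) = 0"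
    using sum_diff sA sB AA swap BB Bv Av Av_eq unfolding cA by linarith+
  then have "\<forall>x\<in>A. 1 - M x v = 0" "\<forall>x\<in>B. M x v = 0"
    using AB nonneg by (simp_all add: sum_nonneg_eq_0_iff)
  then have "x \<in> A \<Longrightarrow> R x v" "x \<in> B \<Longrightarrow> \<not> R x v"
    using AB by (auto simp: M_def split: if_splits)
  then show ?thesis using x by (auto simp: A_def B_def)
qed

context split_graph
begin

text \<open>Each vertex of \<open>X - {v}\<close> has total degree n - 1, so two of them with equal
  F-degree also have equal F'-degree, yet they are adjacent in one of the colours. Hence the
  F-degrees are distinct, and \<open>pos\<close> makes them exactly 1, ..., n - 1. The threshold
  structure then fixes the edges at v, and some vertex has the same degree as v in the colour
  joining them.\<close>

lemma no_two_colouring_aux: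
  assumes n: "card X = n" "n \<ge> 2" and v: "v \<in> X"
    and d0: "\<And>x. x \<in> X - {v} \<Longrightarrow> d x = 0" and dv: "d v < n div 2"
    and F: "F \<union> F' = E" "F \<inter> F' = {}"
    and irr: "locally_irregular F" "locally_irregular F'"
    and pos: "\<And>x. x \<in> X - {v} \<Longrightarrow> neighbors F x \<noteq> {}"
  shows False
proof -
  define W where "W = X - {v}"
  have XW: "X = insert v W" "v \<notin> W" "finite W" using v finite_X by (auto simp: W_def)
  have cW: "card W = n - 1" using XW n by simp
  have fin: "finite (neighbors H x)" if "H \<subseteq> E" for H x
    by (rule finite_subset[OF _ finite_N[of x]]) (use that in \<open>auto simp: neighbors_def\<close>)
  have sub: "F \<subseteq> E" "F' \<subseteq> E" using F by auto
  have deg: "deg F x = card (neighbors F x)" "deg F' x = card (neighbors F' x)" for x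
    using deg_eq_card_neighbors[OF graph] sub by blast+
  have N_eq: "N x = neighbors F x \<union> neighbors F' x" "neighbors F x \<inter> neighbors F' x = {}" for x
    using F by (auto simp: neighbors_def)
  have irrF: "card (neighbors F x) \<noteq> card (neighbors F y)" if "y \<in> neighbors F x" for x y
    using irr(1) that unfolding locally_irregular_def deg by (auto simp: neighbors_def)
  have irrF': "card (neighbors F' x) \<noteq> card (neighbors F' y)" if "y \<in> neighbors F' x" for x y
    using irr(2) that unfolding locally_irregular_def deg by (auto simp: neighbors_def)
  have N_W: "N x = X - {x}" if "x \<in> W" for x
  proof -
    have "N x \<inter> (V - X) = {}"
      using d0[of x] that finite_N[of x] by (auto simp: d_def W_def)
    then show ?thesis using N_clique[of x] that by (auto simp: W_def)
  qed
  have split: "card (neighbors F x) + card (neighbors F' x) = n - 1" if "x \<in> W" for x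
  proof -
    have "card (neighbors F x) + card (neighbors F' x) = card (N x)"
      unfolding N_eq(1) using N_eq(2) fin sub by (simp add: card_Un_disjoint)
    then show ?thesis using N_W[OF that] that n by (simp add: W_def)
  qed
  have inj: "inj_on (\<lambda>x. card (neighbors F x)) W"
  proof (rule inj_onI, rule ccontr)
    fix x y assume xy: "x \<in> W" "y \<in> W" "card (neighbors F x) = card (neighbors F y)" "x \<noteq> y"
    then have "y \<in> neighbors F x \<or> y \<in> neighbors F' x"
      using N_W[of x] N_eq(1)[of x] by (auto simp: W_def)
    then show False
      using irrF[of y x] irrF'[of y x] xy split[of x] split[of y] by auto
  qed
  have "(\<lambda>x. card (neighbors F x)) ` W \<subseteq> {1..n - 1}"
  proof -
    have "card (neighbors F x) \<ge> 1" if "x \<in> W" for x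
      using pos[of x] fin[OF sub(1), of x] that by (simp add: W_def Suc_le_eq card_gt_0_iff)
    then show ?thesis using split by fastforce
  qed
  then have img: "(\<lambda>x. card (neighbors F x)) ` W = {1..n - 1}"
    using card_image[OF inj] cW by (intro card_subset_eq) auto
  have bij: "bij_betw (\<lambda>x. card (neighbors F x)) W {1..n - 1}"
    using inj img by (simp add: bij_betw_def)
  have thr: "v \<in> neighbors F x \<longleftrightarrow> n \<le> 2 * card (neighbors F x)" if "x \<in> W" for x
  proof (rule distinct_degrees_threshold[where R = "\<lambda>x y. y \<in> neighbors F x"
        and \<rho> = "\<lambda>x. card (neighbors F x)"])
    show "card (neighbors F x) = card {y \<in> insert v W - {x}. y \<in> neighbors F x}" if "x \<in> W" for x
    proof -
      have "{y \<in> insert v W - {x}. y \<in> neighbors F x} = neighbors F x"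
        using N_W[OF that] N_eq(1)[of x] XW by auto
      then show ?thesis by simp
    qed
    show "y \<in> neighbors F x \<longleftrightarrow> x \<in> neighbors F y" for x y by (rule neighbors_sym)
  qed (use XW n bij that in auto)
  have N_v: "neighbors F v \<union> neighbors F' v = W \<union> (N v \<inter> (V - X))"
    using N_clique[OF v] N_eq(1)[of v] by (auto simp: W_def)
  have Fv: "neighbors F v \<inter> W = {x\<in>W. n \<le> 2 * card (neighbors F x)}"
    using thr neighbors_sym[of _ F v] by auto
  have "{k\<in>{1..n - 1}. n \<le> 2 * k} = {n - n div 2..n - 1}"
    using n by auto
  then have cFv: "card (neighbors F v \<inter> W) = n div 2"
    unfolding Fv using card_bij_betw_Collect[OF bij, of "\<lambda>k. n \<le> 2 * k"] n by simp
  have "W = (neighbors F v \<inter> W) \<union> (neighbors F' v \<inter> W)" using N_v by auto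
  then have cFv': "card (neighbors F v \<inter> W) + card (neighbors F' v \<inter> W) = n - 1"
    using cW N_eq(2)[of v] XW(3)
    by (metis card_Un_disjoint finite_Int inf_assoc inf_commute inf_bot_right)
  define p where "p = card (neighbors F v - W)"
  define q where "q = card (neighbors F' v - W)"
  have r_v: "card (neighbors F v) = n div 2 + p"
    using cFv card_Diff_subset_Int[of "neighbors F v" W] XW(3) fin[OF sub(1), of v]
      card_mono[of "neighbors F v" "neighbors F v \<inter> W"] by (simp add: p_def)
  have b_v: "card (neighbors F' v) = n - 1 - n div 2 + q"
    using cFv cFv' card_Diff_subset_Int[of "neighbors F' v" W] XW(3) fin[OF sub(2), of v]
      card_mono[of "neighbors F' v" "neighbors F' v \<inter> W"] by (simp add: q_def)
  have pq: "p + q = d v"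
  proof -
    have "W \<inter> (V - X) = {}" by (auto simp: W_def)
    then have "N v \<inter> (V - X) = (neighbors F v - W) \<union> (neighbors F' v - W)"
      using N_v by blast
    then show ?thesis
      unfolding d_def p_def q_def using N_eq(2)[of v] fin sub
      by (simp, subst card_Un_disjoint) auto
  qed
  show False
  \<comment> \<open>Parity decides which colour gives the conflict. For even n the F-degrees of the
    F-neighbours of v start at n div 2, the number of F-edges from v into \<open>W\<close>. For odd
    n they start one higher, but the F'-degrees of the F'-neighbours of v start at n div 2, the
    number of its F'-edges into \<open>W\<close>.\<close>
  proof (cases "even n")
    case True
    have "n div 2 + p \<in> {1..n - 1}" using pq dv by auto
    then obtain x where x: "x \<in> W" "card (neighbors F x) = n div 2 + p"
      using img by (metis (no_types, lifting) imageE)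
    then have "v \<in> neighbors F x" using thr[OF x(1)] True by auto
    then show False using irrF[of v x] x r_v by simp
  next
    case False
    have "n div 2 - q \<in> {1..n - 1}" using pq dv by auto
    then obtain x where x: "x \<in> W" "card (neighbors F x) = n div 2 - q"
      using img by (metis (no_types, lifting) imageE)
    have "\<not> n \<le> 2 * (n div 2 - q)" using False by presburger
    then have "v \<notin> neighbors F x" using thr[OF x(1)] x(2) by simp
    then have "v \<in> neighbors F' x" using N_W[OF x(1)] N_eq(1)[of x] x v XW by auto
    moreover have "card (neighbors F' x) = card (neighbors F' v)"
      using split[OF x(1)] x(2) b_v pq dv by linarith
    ultimately show False using irrF' by metis
  qed
qed

text \<open>If some clique vertex x other than v has no edge of colour 0, all its edges have colour
  1. Then every clique vertex other than v meets an edge of colour 1, and exchanging the colours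
  restores \<open>pos\<close>.\<close>

lemma no_two_colouring:
  assumes n: "card X = n" "n \<ge> 2" and v: "v \<in> X"
    and d0: "\<And>x. x \<in> X - {v} \<Longrightarrow> d x = 0" and dv: "d v < n div 2"
  shows "\<not> irr_decomp E 2 c"
proof
  assume c: "irr_decomp E 2 c"
  define F where "F = {e\<in>E. c e = 0}"
  define F' where "F' = {e\<in>E. c e = 1}"
  have F: "F \<union> F' = E" "F \<inter> F' = {}"
    using c by (fastforce simp: F_def F'_def irr_decomp_def)+
  have irr: "locally_irregular F" "locally_irregular F'"
    using c by (auto simp: F_def F'_def irr_decomp_def)
  show False
  proof (cases "\<forall>x\<in>X - {v}. neighbors F x \<noteq> {}")
    case True
    then show False using no_two_colouring_aux[OF n v d0 dv F irr] by blast
  next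
    case False
    then obtain x where x: "x \<in> X - {v}" "neighbors F x = {}" by auto
    have "neighbors F' y \<noteq> {}" if y: "y \<in> X - {v}" for y
    proof -
      obtain z where "z \<in> X" "z \<noteq> y" "z = x \<or> y = x"
        using x v y by (cases "x = y") auto
      then have "z \<in> N y" using N_clique[of y] y by auto
      then have "z \<in> neighbors F y \<or> z \<in> neighbors F' y"
        using F by (auto simp: neighbors_def)
      moreover have "z \<notin> neighbors F y"
        using x \<open>z = x \<or> y = x\<close> neighbors_sym[of z F y] by auto
      ultimately show ?thesis by auto
    qed
    moreover have "F' \<union> F = E" "F' \<inter> F = {}" using F by auto
    ultimately show False
      using no_two_colouring_aux[OF n v d0 dv _ _ irr(2,1)] by blast
  qed
qed

text \<open>The third colour is a star at v that contains two edges of the clique. What is left is a split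
  graph with clique X - {v} in which v has become a vertex of the stable side.\<close>

lemma three_colouring:
  assumes n: "card X = n" "n \<ge> 5" and v: "v \<in> X"
    and d0: "\<And>x. x \<in> X - {v} \<Longrightarrow> d x = 0"
  shows "\<exists>c. irr_decomp E 3 c"
proof -
  obtain T where T: "T \<subseteq> X - {v}" "card T = 2"
  proof -
    have "2 \<le> card (X - {v})" using n v by simp
    then show ?thesis using that obtain_subset_with_card_n by metis
  qed
  then have finT: "finite T" "T \<noteq> {}" by (auto simp: card_ge_0_finite)
  \<comment> \<open>The two clique edges give the centre degree at least 2 even if
    \<open>d v = 0\<close>, while all leaves have degree 1.\<close>
  define S where "S = T \<union> (N v \<inter> (V - X))"
  have vS: "v \<notin> S" using T v by (auto simp: S_def)
  have SN: "S \<subseteq> N v" using T N_clique[OF v] by (auto simp: S_def)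
  define F where "F = {e\<in>E. \<exists>s\<in>S. e = {v, s}}"
  have in_F: "{x, y} \<in> F \<longleftrightarrow> x = v \<and> y \<in> S \<or> y = v \<and> x \<in> S" for x y
    using SN by (auto simp: F_def neighbors_def doubleton_eq_iff insert_commute)
  have nbF: "neighbors F v = S" "\<And>s. s \<in> S \<Longrightarrow> neighbors F s = {v}"
    using vS by (auto simp: neighbors_def in_F)
  have degF: "deg F x = card (neighbors F x)" for x
    by (rule deg_eq_card_neighbors[OF graph]) (auto simp: F_def)
  have "card S \<ge> 2"
    using T card_mono[of S T] finT finite_N[of v] by (simp add: S_def)
  then have irrF: "locally_irregular F"
    unfolding locally_irregular_def degF by (auto simp: in_F nbF)
  let ?X = "X - {v}" and ?E = "E - F"
  have in_E: "{x, y} \<in> ?E \<longleftrightarrow> {x, y} \<in> E \<and> \<not> (x = v \<and> y \<in> S \<or> y = v \<and> x \<in> S)" for x y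
    by (simp add: in_F)
  interpret G: split_graph V ?E ?X
  proof
    show "simple_graph V ?E" using graph by (auto simp: simple_graph_def)
    show "is_clique V ?E ?X" using clique unfolding is_clique_def in_E by auto
    have "{v} \<notin> E" using graph by (fastforce simp: simple_graph_def)
    moreover have "y \<in> S" if "{v, y} \<in> E" "y \<in> V - X" for y
      using that v by (auto simp: S_def neighbors_def)
    moreover have "{x, y} \<notin> E" if "x \<in> V - X" "y \<in> V - X" for x y
      using that stable by (simp add: stable_set_def)
    ultimately have "{x, y} \<notin> ?E" if "x \<in> insert v (V - X)" "y \<in> insert v (V - X)" for x y
      using that unfolding in_E by (auto simp: insert_commute[of _ v])
    moreover have "V - ?X = insert v (V - X)" "v \<in> V" using X_subset v by auto
    ultimately show "stable_set V ?E (V - ?X)"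
      by (simp add: stable_set_def)
  qed
  have "\<exists>c. irr_decomp ?E 2 c"
  proof (rule G.many_attached_colouring)
    show "card ?X = n - 1" using n v by simp
    show "n - 1 \<ge> 4" using n by simp
    \<comment> \<open>Outside \<open>T\<close> the edge to v survives and now counts as an outer
      edge, which leaves n - 3 attached vertices.\<close>
    have "G.d x \<ge> 1" if "x \<in> ?X - T" for x
    proof -
      have "{x, v} \<in> ?E"
        using that v clique by (auto simp: in_F S_def is_clique_def)
      then show ?thesis
        using G.d_pos[of x v] that v X_subset by (auto simp: neighbors_def insert_commute)
    qed
    then have "card (?X - T) \<le> card {x\<in>?X. G.d x \<ge> 1}"
      using finite_X by (intro card_mono) auto
    moreover have "card (?X - T) = n - 3"
      using T finT n v by (simp add: card_Diff_subset)
    ultimately show "(n - 1) div 2 \<le> card {x\<in>?X. G.d x \<ge> 1}" using n by linarith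
    \<comment> \<open>Any s in \<open>T\<close> is missed: its edge to v belongs to the star, and
      \<open>d s = 0\<close> excludes the other outer vertices.\<close>
    show "\<not> ?X \<subseteq> neighbors ?E y" if y: "y \<in> V - ?X" for y
    proof -
      obtain s where s: "s \<in> T" using finT by auto
      have "s \<notin> neighbors ?E y"
      proof
        assume "s \<in> neighbors ?E y"
        then have e: "{y, s} \<in> E" "\<not> (y = v \<and> s \<in> S)" "s \<in> N y"
          by (auto simp: neighbors_def in_F)
        then have "y \<in> V - X" using s y by (auto simp: S_def)
        then show False using d_pos[OF e(3)] d0[of s] s T by auto
      qed
      then show ?thesis using s T by auto
    qed
  qed
  then obtain c where c: "irr_decomp ?E 2 c" by blast
  define c' where "c' e = (if e \<in> F then 2 else c e)" for e
  have c2: "c e < 2" if "e \<in> E" "e \<notin> F" for e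
    using c that by (simp add: irr_decomp_def)
  then have c2': "e \<in> F" if "e \<in> E" "c e = 2" for e
    using that by (metis less_irrefl)
  have "F \<subseteq> E" by (auto simp: F_def)
  then have "{e\<in>E. c' e = 2} = F" using c2' by (auto simp: c'_def split: if_splits)
  moreover have "{e\<in>E. c' e = j} = {e\<in>?E. c e = j}" if "j < 2" for j
    using that by (auto simp: c'_def)
  moreover have "c' e < 3" if "e \<in> E" for e
    using c2[OF that] by (auto simp: c'_def)
  ultimately have "irr_decomp E 3 c'"
    using c irrF by (auto simp: irr_decomp_def numeral_3_eq_3 less_Suc_eq numeral_2_eq_2)
  then show ?thesis by blast
qed

end

section \<open>Combining the cases\<close>

lemma irr_decomp_mono: "irr_decomp E k c \<Longrightarrow> k \<le> m \<Longrightarrow> irr_decomp E m c"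
proof -
  assume c: "irr_decomp E k c" and km: "k \<le> m"
  have "{e\<in>E. c e = j} = {}" if "\<not> j < k" for j
    using c that by (auto simp: irr_decomp_def)
  moreover have "locally_irregular {}" by (simp add: locally_irregular_def)
  ultimately have "locally_irregular {e\<in>E. c e = j}" for j
    using c unfolding irr_decomp_def by (metis (no_types, lifting))
  then show ?thesis using c km by (auto simp: irr_decomp_def)
qed

context split_graph
begin

lemma two_colourable:
  assumes n: "card X = n" "n \<ge> 10"
    and maximal: "\<And>y. y \<in> V - X \<Longrightarrow> \<not> X \<subseteq> N y"
    and "sum d X \<ge> n div 2 \<or> card {x\<in>X. d x \<ge> 1} \<ge> 2"
  shows "\<exists>c. irr_decomp E 2 c"
proof (cases "sum d X \<ge> n div 2")
  case heavy: True
  show ?thesis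
  proof (cases "card {x\<in>X. d x \<ge> 1} \<ge> n div 2")
    case True
    then show ?thesis using many_attached_colouring[OF n(1) _ True maximal] n by simp
  next
    case False
    then show ?thesis using heavy_colouring[OF n(1) _ _ heavy] n by simp
  qed
next
  case False
  then show ?thesis using assms(4) sparse_colouring[OF n] by simp
qed

end

theorem theorem1p3:
  fixes V :: "'a set" and E :: "'a set set" and X :: "'a set"
    and v :: "nat \<Rightarrow> 'a" and n :: nat
  assumes "simple_graph V E"
    and "maximal_clique V E X"
    and "stable_set V E (V - X)"
    and "bij_betw v {1..n} X"
    and "\<And>i j. 1 \<le> i \<Longrightarrow> i \<le> j \<Longrightarrow> j \<le> n \<Longrightarrow>
           card (neighbors E (v j) \<inter> (V - X)) \<le> card (neighbors E (v i) \<inter> (V - X))"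
    and "n \<ge> 10"
  shows "(irr_chromatic_index E \<le> 2 \<longleftrightarrow>
            card (neighbors E (v 1) \<inter> (V - X)) \<ge> n div 2 \<or>
            card (neighbors E (v 2) \<inter> (V - X)) \<ge> 1)
       \<and> (irr_chromatic_index E = 3 \<longleftrightarrow>
            card (neighbors E (v 1) \<inter> (V - X)) < n div 2 \<and>
            card (neighbors E (v 2) \<inter> (V - X)) = 0)"
proof -
  interpret split_graph V E X
    using assms(1-3) by unfold_locales (simp_all add: maximal_clique_def)
  have mono: "d (v j) \<le> d (v i)" if "1 \<le> i" "i \<le> j" "j \<le> n" for i j
    using assms(5)[OF that] by (simp add: d_def)
  have n: "card X = n" using bij_betw_same_card[OF assms(4)] by simp
  have img: "v ` {1..n} = X" and inj: "inj_on v {1..n}"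
    using assms(4) by (auto simp: bij_betw_def)
  have v12: "v 1 \<in> X" "v 2 \<in> X" "v 1 \<noteq> v 2"
    using img inj_onD[OF inj, of 1 2] assms(6) by auto
  have maximal: "\<not> X \<subseteq> N y" if y: "y \<in> V - X" for y
  proof
    assume "X \<subseteq> N y"
    then have "{y, x} \<in> E" "{x, y} \<in> E" if "x \<in> X" for x
      using that by (auto simp: neighbors_def insert_commute)
    then have "is_clique V E (insert y X)"
      using clique y by (auto simp: is_clique_def)
    then show False using assms(2) y by (auto simp: maximal_clique_def)
  qed
  have three: "irr_chromatic_index E = 3" if le: "d (v 1) < n div 2" "d (v 2) = 0"
  proof -
    have d0: "d x = 0" if x: "x \<in> X - {v 1}" for x
    proof -
      obtain i where i: "i \<in> {1..n}" "x = v i" using x img by blast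
      then have "2 \<le> i" using x by (cases "i = 1") auto
      then show ?thesis using mono[of 2 i] i le by simp
    qed
    have "\<not> irr_decomp E k c" if "k < 3" for k c
      using no_two_colouring[OF n _ v12(1) d0 le(1)] irr_decomp_mono[of E k c 2] that assms(6)
      by fastforce
    moreover obtain c where "irr_decomp E 3 c"
      using three_colouring[OF n _ v12(1) d0] assms(6) by auto
    ultimately show ?thesis
      unfolding irr_chromatic_index_def by (intro Least_equality) (auto simp: not_less[symmetric])
  qed
  have two: "irr_chromatic_index E \<le> 2" if large: "d (v 1) \<ge> n div 2 \<or> d (v 2) \<ge> 1"
  proof -
    have "sum d X \<ge> n div 2" if "d (v 1) \<ge> n div 2"
      using that member_le_sum[OF v12(1), of d] finite_X by simp
    moreover have "card {x\<in>X. d x \<ge> 1} \<ge> 2" if "d (v 2) \<ge> 1"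
    proof -
      have "{v 1, v 2} \<subseteq> {x\<in>X. d x \<ge> 1}"
        using that mono[of 1 2] assms(6) v12 by auto
      then have "card {v 1, v 2} \<le> card {x\<in>X. d x \<ge> 1}"
        using finite_X by (intro card_mono) auto
      then show ?thesis using v12 by simp
    qed
    ultimately obtain c where "irr_decomp E 2 c"
      using two_colourable[OF n assms(6) maximal] large by blast
    then show ?thesis
      unfolding irr_chromatic_index_def by (intro Least_le) blast
  qed
  \<comment> \<open>The two conditions on d are complementary, and the index values at most 2 and
    equal to 3 exclude each other, so the two implications give both equivalences.\<close>
  show ?thesis
    using two three unfolding d_def by linarith
qed

end
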